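(* \textsc{Multi-STC} can be solved in $\mathcal{O}((k_1+1)^{k_1}\cdot(k_1m+nm))$ time, where $n=|V|$, $m=|E|$ for the input graph $G=(V,E)$, and $k_1=k_1(G)$.
   Context: A $c$-labeling of an undirected graph $G=(V,E)$ is a partition $L=(S^1_L,\dots,S^c_L,W_L)$ of $E$; edges in $S^i_L$ are strong (color $i$), edges in $W_L$ are weak. $L$ is an STC-labeling if there is no pair of edges $\{u,v\},\{v,w\}$ in the same $S^i_L$ with $\{u,w\}\notin E$. \textsc{Multi-STC}: given $G$ and $c,k\in\mathbb{N}$, decide whether there is a $c$-labeling which is an STC-labeling with $|W_L|\le k$. $k_1(G)$ is the minimum number of weak edges in an STC-labeling of $G$ with one strong color ($c=1$). *)

theory Defs
  imports Main "HOL-Library.Disjoint_Sets"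
begin

definition ugraph :: "'a set \<Rightarrow> 'a set set \<Rightarrow> bool" where
  "ugraph V E \<longleftrightarrow> finite V \<and> (\<forall>e\<in>E. e \<subseteq> V \<and> card e = 2)"

text \<open>The parts of a labeling may be empty, so \<^const>\<open>partition_on\<close> does not apply.
  Only the classes \<open>S 1, \<dots>, S c\<close> are relevant.\<close>

definition labeling :: "'a set set \<Rightarrow> nat \<Rightarrow> (nat \<Rightarrow> 'a set set) \<Rightarrow> 'a set set \<Rightarrow> bool" where
  "labeling E c S W \<longleftrightarrow>
     (\<Union>i\<in>{1..c}. S i) \<union> W = E \<and>
     disjoint_family_on S {1..c} \<and>
     (\<forall>i\<in>{1..c}. S i \<inter> W = {})"

text \<open>The condition \<open>u \<noteq> w\<close> says that \<open>{u, v}\<close> and \<open>{v, w}\<close> are two different edges; without it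
  every strong edge would violate the property together with itself.\<close>

definition stc_labeling :: "'a set set \<Rightarrow> nat \<Rightarrow> (nat \<Rightarrow> 'a set set) \<Rightarrow> 'a set set \<Rightarrow> bool" where
  "stc_labeling E c S W \<longleftrightarrow> labeling E c S W \<and>
     \<not> (\<exists>i\<in>{1..c}. \<exists>u v w. u \<noteq> w \<and> {u, v} \<in> S i \<and> {v, w} \<in> S i \<and> {u, w} \<notin> E)"

definition multi_stc :: "'a set set \<Rightarrow> nat \<Rightarrow> nat \<Rightarrow> bool" where
  "multi_stc E c k \<longleftrightarrow> (\<exists>S W. stc_labeling E c S W \<and> card W \<le> k)"

definition k1 :: "'a set set \<Rightarrow> nat" where
  "k1 E = (LEAST k. \<exists>S W. stc_labeling E 1 S W \<and> card W = k)"

text \<open>The model of computation is the random access machine with uniform cost, with structured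
  control flow instead of jumps. Programs work on registers and on a memory, both indexed by and holding natural numbers.
  Every elementary operation and every test costs one unit of time. The only arithmetic operations
  are addition and truncated subtraction; there is deliberately no multiplication, which would be
  unrealistically powerful at unit cost. A program mentions only finitely many registers by name;
  unbounded storage is reached by indirect addressing through \<open>Load\<close> and \<open>Store\<close>.\<close>

type_synonym state = "(nat \<Rightarrow> nat) \<times> (nat \<Rightarrow> nat)"

datatype prog =
    Skip
  | Const nat nat
  | Move nat nat
  | Add nat nat nat
  | Sub nat nat nat
  | Load nat nat
  | Store nat nat
  | Seq prog prog
  | IfLess nat nat prog prog
  | WhileLess nat nat prog

text \<open>\<open>exec p s t s'\<close>: started in state \<open>s\<close>, program \<open>p\<close> halts in state \<open>s'\<close> after time \<open>t\<close>.\<close>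

inductive exec :: "prog \<Rightarrow> state \<Rightarrow> nat \<Rightarrow> state \<Rightarrow> bool" where
  exec_Skip: "exec Skip s 1 s"
| exec_Const: "exec (Const x a) (R, M) 1 (R(x := a), M)"
| exec_Move: "exec (Move x y) (R, M) 1 (R(x := R y), M)"
| exec_Add: "exec (Add x y z) (R, M) 1 (R(x := R y + R z), M)"
| exec_Sub: "exec (Sub x y z) (R, M) 1 (R(x := R y - R z), M)"
| exec_Load: "exec (Load x y) (R, M) 1 (R(x := M (R y)), M)"
| exec_Store: "exec (Store x y) (R, M) 1 (R, M(R x := R y))"
| exec_Seq: "exec p s t s' \<Longrightarrow> exec q s' t' s'' \<Longrightarrow> exec (Seq p q) s (t + t') s''"
| exec_IfTrue: "R x < R y \<Longrightarrow> exec p (R, M) t s' \<Longrightarrow> exec (IfLess x y p q) (R, M) (t + 1) s'"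
| exec_IfFalse: "\<not> R x < R y \<Longrightarrow> exec q (R, M) t s' \<Longrightarrow> exec (IfLess x y p q) (R, M) (t + 1) s'"
| exec_WhileFalse: "\<not> R x < R y \<Longrightarrow> exec (WhileLess x y p) (R, M) 1 (R, M)"
| exec_WhileTrue: "R x < R y \<Longrightarrow> exec p (R, M) t s' \<Longrightarrow> exec (WhileLess x y p) s' t' s'' \<Longrightarrow>
    exec (WhileLess x y p) (R, M) (t + t' + 1) s''"

inductive_cases exec_SkipE: "exec Skip s t s'"
  and exec_ConstE: "exec (Const x a) s t s'"
  and exec_MoveE: "exec (Move x y) s t s'"
  and exec_AddE: "exec (Add x y z) s t s'"
  and exec_SubE: "exec (Sub x y z) s t s'"
  and exec_LoadE: "exec (Load x y) s t s'"
  and exec_StoreE: "exec (Store x y) s t s'"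
  and exec_SeqE: "exec (Seq p q) s t s'"
  and exec_IfE: "exec (IfLess x y p q) (R, M) t s'"
  and exec_WhileE: "exec (WhileLess x y p) (R, M) t s'"

lemma exec_deterministic:
  "exec p s t s' \<Longrightarrow> exec p s u s'' \<Longrightarrow> u = t \<and> s'' = s'"
proof (induction arbitrary: u s'' rule: exec.induct)
  case (exec_Seq p s t s' q t' s2)
  from exec_Seq.prems obtain u1 u2 s1
    where "u = u1 + u2" "exec p s u1 s1" "exec q s1 u2 s''"
    by (rule exec_SeqE)
  with exec_Seq.IH show ?case by metis
next
  case (exec_IfTrue R x y p M t s' q)
  from exec_IfTrue.prems exec_IfTrue.hyps(1) obtain u1
    where "u = u1 + 1" "exec p (R, M) u1 s''"
    by (elim exec_IfE) simp_all
  with exec_IfTrue.IH show ?case by simp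
next
  case (exec_IfFalse R x y q M t s' p)
  from exec_IfFalse.prems exec_IfFalse.hyps(1) obtain u1
    where "u = u1 + 1" "exec q (R, M) u1 s''"
    by (elim exec_IfE) simp_all
  with exec_IfFalse.IH show ?case by simp
next
  case (exec_WhileFalse R x y p M)
  from exec_WhileFalse.prems exec_WhileFalse.hyps show ?case
    by (elim exec_WhileE) simp_all
next
  case (exec_WhileTrue R x y p M t s' t' s2)
  from exec_WhileTrue.prems exec_WhileTrue.hyps(1) obtain u1 u2 s1
    where "u = u1 + u2 + 1" "exec p (R, M) u1 s1" "exec (WhileLess x y p) s1 u2 s''"
    by (elim exec_WhileE) simp_all
  with exec_WhileTrue.IH show ?case by metis
qed (auto elim: exec_SkipE exec_ConstE exec_MoveE exec_AddE exec_SubE exec_LoadE exec_StoreE)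

text \<open>A graph with \<open>n\<close> vertices is given over the vertex set \<open>{..<n}\<close>, by a list that contains each
  edge exactly once, in an arbitrary order and with an arbitrary order of its two endpoints.\<close>

definition edge_list :: "(nat \<times> nat) list \<Rightarrow> nat set set \<Rightarrow> bool" where
  "edge_list es E \<longleftrightarrow>
     distinct (map (\<lambda>(u, v). {u, v}) es) \<and> set (map (\<lambda>(u, v). {u, v}) es) = E"

definition input_word :: "nat \<Rightarrow> (nat \<times> nat) list \<Rightarrow> nat \<Rightarrow> nat \<Rightarrow> nat list" where
  "input_word n es c k = [n, length es, c, k] @ concat (map (\<lambda>(u, v). [u, v]) es)"

text \<open>The input is stored in an initial segment of the memory; everything else is \<open>0\<close>.\<close>

definition init_state :: "nat list \<Rightarrow> state" where
  "init_state xs = ((\<lambda>_. 0), (\<lambda>i. if i < length xs then xs ! i else 0))"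

text \<open>The answer is returned in register \<open>0\<close>: \<open>1\<close> for yes and \<open>0\<close> for no.\<close>

definition answer :: "state \<Rightarrow> nat" where
  "answer s = fst s 0"

text \<open>\<open>p\<close> decides Multi-STC on all instances, in time \<open>O(f n E c k)\<close> with a constant that is uniform
  over all instances. Since every program takes at least one step, the bound is read as at least
  \<open>1\<close>; otherwise a bound that vanishes on edgeless graphs could not be met on them.\<close>

definition solves_multi_stc_in_time ::
  "prog \<Rightarrow> (nat \<Rightarrow> nat set set \<Rightarrow> nat \<Rightarrow> nat \<Rightarrow> nat) \<Rightarrow> bool" where
  "solves_multi_stc_in_time p f \<longleftrightarrow>
     (\<exists>C::nat. \<forall>n E es c k. ugraph {..<n} E \<longrightarrow> edge_list es E \<longrightarrow>
        (\<exists>t s. exec p (init_state (input_word n es c k)) t s \<and>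
           answer s = (if multi_stc E c k then 1 else 0) \<and>
           t \<le> C * max 1 (f n E c k)))"

end

theory Submission
  imports Defs
begin

text \<open>The edges of the graph are the vertices of a conflict graph, in which \<open>{u, v}\<close> and \<open>{v, w}\<close> are
  adjacent iff \<open>{u, w}\<close> is not an edge. An STC-labeling with \<open>c\<close> colors is a proper coloring of an
  induced subgraph, and \<open>k1\<close> is the vertex cover number of the conflict graph.

  At most \<open>2nm\<close> ordered conflicts exist, and with an adjacency matrix all of them are listed in time
  \<open>O(nm)\<close>. A minimum vertex cover is found by trying \<open>t = 0, 1, \<dots>\<close> and all \<open>2 ^ t\<close> bit strings of
  length \<open>t\<close>: one pass over the list suffices per string, each conflict that is not yet covered
  consuming a bit that selects the end to be added. The first success is at \<open>t = k1\<close>.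

  If \<open>c > k1\<close>, every element of the cover gets a color of its own and the remaining edges, which are
  independent, share another one. Otherwise all \<open>(c + 1) ^ k1 \<le> (k1 + 1) ^ k1\<close> partial colorings of the
  cover are tried. The edges outside of the cover are independent, so such an edge must stay weak
  only if all \<open>c\<close> colors occur among its conflicts, which one pass over the list determines.\<close>

text \<open>The obstacle is that a candidate may cost only a constant times the length of the
  conflict list, on a machine without multiplication. Candidates are therefore digit strings that
  are incremented in place; advancing one costs O(t), which a pass absorbs because t <= k1 <= m. No
  table of quadratic size is ever initialized: when m < n, clearing an adjacency matrix would
  already exceed O(nm). The matrix and the table of seen colors rely on blank memory, on precomputed
  row offsets, and on stamps in place of clearing.

  The budgets below k1 are paid for by a geometric sum: all rounds up to k1 together try at most
  2^(k1+1) strings, and 2^k1 <= (k1+1)^k1. Stopping at exactly k1 matters for the second search as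
  well, since k1 is the number of its digits, and the test c > k1 removes every instance whose radix
  c + 1 would exceed k1 + 1. The numbers given to the cover elements by the first search index their
  digits in the second.\<close>

section \<open>Weakest preconditions and arrays\<close>

text \<open>With \<open>Suc 0\<close> as the normal form, costs would not add up to numerals.\<close>

declare One_nat_def [simp del]

text \<open>Total correctness together with cost. Since execution is deterministic, the rules for
  single commands are equivalences, so straight-line code is verified by simplification.\<close>

definition wp :: "prog \<Rightarrow> state \<Rightarrow> (nat \<Rightarrow> state \<Rightarrow> bool) \<Rightarrow> bool" where
  "wp p s Q \<longleftrightarrow> (\<exists>t s'. exec p s t s' \<and> Q t s')"

lemma wp_Skip [simp]: "wp Skip s Q \<longleftrightarrow> Q 1 s"
  unfolding wp_def by (metis exec_Skip exec_deterministic)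

lemma wp_Const [simp]: "wp (Const x a) (R, M) Q \<longleftrightarrow> Q 1 (R(x := a), M)"
  unfolding wp_def by (metis exec_Const exec_deterministic)

lemma wp_Move [simp]: "wp (Move x y) (R, M) Q \<longleftrightarrow> Q 1 (R(x := R y), M)"
  unfolding wp_def by (metis exec_Move exec_deterministic)

lemma wp_Add [simp]: "wp (Add x y z) (R, M) Q \<longleftrightarrow> Q 1 (R(x := R y + R z), M)"
  unfolding wp_def by (metis exec_Add exec_deterministic)

lemma wp_Sub [simp]: "wp (Sub x y z) (R, M) Q \<longleftrightarrow> Q 1 (R(x := R y - R z), M)"
  unfolding wp_def by (metis exec_Sub exec_deterministic)

lemma wp_Load [simp]: "wp (Load x y) (R, M) Q \<longleftrightarrow> Q 1 (R(x := M (R y)), M)"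
  unfolding wp_def by (metis exec_Load exec_deterministic)

lemma wp_Store [simp]: "wp (Store x y) (R, M) Q \<longleftrightarrow> Q 1 (R, M(R x := R y))"
  unfolding wp_def by (metis exec_Store exec_deterministic)

lemma wp_Seq [simp]: "wp (Seq p q) s Q \<longleftrightarrow> wp p s (\<lambda>t s'. wp q s' (\<lambda>t'. Q (t + t')))"
proof
  assume "wp (Seq p q) s Q"
  then show "wp p s (\<lambda>t s'. wp q s' (\<lambda>t'. Q (t + t')))"
    unfolding wp_def by (metis exec_SeqE)
next
  assume "wp p s (\<lambda>t s'. wp q s' (\<lambda>t'. Q (t + t')))"
  then show "wp (Seq p q) s Q"
    unfolding wp_def by (metis exec_Seq)
qed

lemma wp_IfLess [simp]:
  "wp (IfLess x y p q) (R, M) Q \<longleftrightarrow>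
     (if R x < R y then wp p (R, M) (\<lambda>t. Q (t + 1)) else wp q (R, M) (\<lambda>t. Q (t + 1)))"
proof -
  have "exec (IfLess x y p q) (R, M) u s' \<longleftrightarrow>
      (\<exists>t. u = t + 1 \<and> (if R x < R y then exec p (R, M) t s' else exec q (R, M) t s'))" for u s'
    using exec_IfTrue[of R x y p M _ s' q] exec_IfFalse[of R x y q M _ s' p]
    by (auto elim!: exec_IfE)
  then show ?thesis
    unfolding wp_def by auto
qed

lemma wp_mono: "wp p s P \<Longrightarrow> (\<And>t R M. P t (R, M) \<Longrightarrow> Q t (R, M)) \<Longrightarrow> wp p s Q"
  unfolding wp_def by (metis surj_pair)

lemma wp_post:
  assumes "wp p s (\<lambda>t (R, M). P t R M)" "\<And>t R M. P t R M \<Longrightarrow> Q t (R, M)"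
  shows "wp p s Q"
  using assms by (auto intro: wp_mono)

lemma wp_SeqI:
  assumes "wp p s (\<lambda>t (R, M). P t R M)"
    and "\<And>t R M. P t R M \<Longrightarrow> wp q (R, M) (\<lambda>t'. Q (t + t'))"
  shows "wp (Seq p q) s Q"
  unfolding wp_Seq using assms by (rule wp_post)

text \<open>The invariant carries the number of completed rounds as an index. This index lets the
  cost \<open>T k\<close> vary from round to round, and it gives termination by induction on
  \<open>N - k\<close>, because the guard can only hold while \<open>k < N\<close>.\<close>

lemma wp_while_aux:
  assumes step: "\<And>k R M. I k R M \<Longrightarrow> R x < R y \<Longrightarrow>
    k < N \<and> wp body (R, M) (\<lambda>t (R', M'). t \<le> T k \<and> I (Suc k) R' M')"
  shows "I k R M \<Longrightarrow> wp (WhileLess x y body) (R, M)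
    (\<lambda>t (R', M'). \<exists>l\<ge>k. I l R' M' \<and> \<not> R' x < R' y \<and> t \<le> (\<Sum>j=k..<l. T j + 1) + 1)"
proof (induction "N - k" arbitrary: k R M rule: less_induct)
  case less
  show ?case
  proof (cases "R x < R y")
    case False
    then show ?thesis
      unfolding wp_def using less.prems by (force intro!: exec_WhileFalse)
  next
    case True
    from step[OF less.prems True] obtain t R' M' where
      k: "k < N" and body: "exec body (R, M) t (R', M')" "t \<le> T k" and I: "I (Suc k) R' M'"
      unfolding wp_def by auto
    have "N - Suc k < N - k"
      using k by simp
    from less.hyps[OF this I] obtain t' R'' M'' l where
      loop: "exec (WhileLess x y body) (R', M') t' (R'', M'')" and
      l: "l \<ge> Suc k" "I l R'' M''" "\<not> R'' x < R'' y" "t' \<le> (\<Sum>j=Suc k..<l. T j + 1) + 1"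
      unfolding wp_def by auto
    have "t + t' + 1 \<le> (\<Sum>j=k..<l. T j + 1) + 1"
      using l(1,4) body(2) by (simp add: sum.atLeast_Suc_lessThan)
    moreover have "exec (WhileLess x y body) (R, M) (t + t' + 1) (R'', M'')"
      using True body(1) loop by (rule exec_WhileTrue)
    ultimately show ?thesis
      unfolding wp_def using l(2,3) Suc_leD[OF l(1)]
      by (intro exI[of _ "t + t' + 1"] exI[of _ "(R'', M'')"]) (simp only: prod.case, metis)
  qed
qed

lemma wp_while:
  assumes "I 0 R M"
    and "\<And>k R M. I k R M \<Longrightarrow> R x < R y \<Longrightarrow>
      k < N \<and> wp body (R, M) (\<lambda>t (R', M'). t \<le> T k \<and> I (Suc k) R' M')"
  shows "wp (WhileLess x y body) (R, M)
    (\<lambda>t (R', M'). \<exists>l. I l R' M' \<and> \<not> R' x < R' y \<and> t \<le> (\<Sum>j<l. T j + 1) + 1)"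
  using wp_while_aux[of I x y N body T 0 R M, OF assms(2,1)]
  by (simp add: atLeast0LessThan)

section \<open>Register names and interleaved arrays\<close>

abbreviation (input) rTmpA :: nat where "rTmpA \<equiv> 2"
abbreviation (input) rTmpB :: nat where "rTmpB \<equiv> 3"
abbreviation (input) rOne :: nat where "rOne \<equiv> 4"
abbreviation (input) rZero :: nat where "rZero \<equiv> 5"
abbreviation (input) rN :: nat where "rN \<equiv> 6"
abbreviation (input) rM :: nat where "rM \<equiv> 7"
abbreviation (input) rC :: nat where "rC \<equiv> 8"
abbreviation (input) rK :: nat where "rK \<equiv> 9"
abbreviation (input) rStride :: nat where "rStride \<equiv> 10"
abbreviation (input) rLen :: nat where "rLen \<equiv> 11"
abbreviation (input) rT :: nat where "rT \<equiv> 12"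
abbreviation (input) rRadix :: nat where "rRadix \<equiv> 13"
abbreviation (input) rFlag :: nat where "rFlag \<equiv> 14"
abbreviation (input) rDone :: nat where "rDone \<equiv> 15"
abbreviation (input) rCarry :: nat where "rCarry \<equiv> 16"
abbreviation (input) rI :: nat where "rI \<equiv> 17"
abbreviation (input) rP :: nat where "rP \<equiv> 18"
abbreviation (input) rW :: nat where "rW \<equiv> 19"
abbreviation (input) rE :: nat where "rE \<equiv> 20"
abbreviation (input) rF :: nat where "rF \<equiv> 21"
abbreviation (input) rU :: nat where "rU \<equiv> 22"
abbreviation (input) rV :: nat where "rV \<equiv> 23"
abbreviation (input) rX :: nat where "rX \<equiv> 24"
abbreviation (input) rY :: nat where "rY \<equiv> 25"
abbreviation (input) rZ :: nat where "rZ \<equiv> 26"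
abbreviation (input) rR :: nat where "rR \<equiv> 27"
abbreviation (input) rStamp :: nat where "rStamp \<equiv> 28"
abbreviation (input) rWeak :: nat where "rWeak \<equiv> 29"
abbreviation (input) rBase :: nat where "rBase \<equiv> 30"

abbreviation (input) aRow :: nat where "aRow \<equiv> 2"
abbreviation (input) aAdj :: nat where "aAdj \<equiv> 3"
abbreviation (input) aLE :: nat where "aLE \<equiv> 4"
abbreviation (input) aLF :: nat where "aLF \<equiv> 5"
abbreviation (input) aDig :: nat where "aDig \<equiv> 6"
abbreviation (input) aPos :: nat where "aPos \<equiv> 7"
abbreviation (input) aSeen :: nat where "aSeen \<equiv> 8"
abbreviation (input) aCnt :: nat where "aCnt \<equiv> 9"

text \<open>All arrays are interleaved behind the input, which ends at \<open>B\<close>: they are unbounded and pairwise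
  disjoint, and initially \<open>0\<close>.\<close>

definition ad :: "nat \<Rightarrow> nat \<Rightarrow> nat \<Rightarrow> nat" where
  "ad B a i = B + 16 * i + a"

lemma ad_eq_iff [simp]: "a < 16 \<Longrightarrow> a' < 16 \<Longrightarrow> ad B a i = ad B a' i' \<longleftrightarrow> a = a' \<and> i = i'"
proof
  assume "a < 16" "a' < 16" "ad B a i = ad B a' i'"
  then have eq: "16 * i + a = 16 * i' + a'"
    by (simp add: ad_def)
  have "a = a'"
    using arg_cong[OF eq, of "\<lambda>x. x mod 16"] \<open>a < 16\<close> \<open>a' < 16\<close> by simp
  with eq show "a = a' \<and> i = i'"
    by simp
qed (simp add: ad_def)

lemma ad_neq_input [simp]: "x < B \<Longrightarrow> ad B a i \<noteq> x" "x < B \<Longrightarrow> x \<noteq> ad B a i"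
  by (auto simp: ad_def)

text \<open>Four doublings produce \<open>16 * i\<close>. The spacing of the arrays is a power of
  two for this reason, and 16 exceeds every array name.\<close>

definition array_addr :: "nat \<Rightarrow> nat \<Rightarrow> prog" where
  "array_addr a y = Seq (Add rTmpA y y) (Seq (Add rTmpA rTmpA rTmpA) (Seq (Add rTmpA rTmpA rTmpA)
     (Seq (Add rTmpA rTmpA rTmpA) (Seq (Const rTmpB a) (Seq (Add rTmpA rTmpA rTmpB)
     (Add rTmpA rTmpA rBase))))))"

definition ALoad :: "nat \<Rightarrow> nat \<Rightarrow> nat \<Rightarrow> prog" where
  "ALoad x a y = Seq (array_addr a y) (Load x rTmpA)"

definition AStore :: "nat \<Rightarrow> nat \<Rightarrow> nat \<Rightarrow> prog" where
  "AStore a y z = Seq (array_addr a y) (Store rTmpA z)"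

lemma wp_array_addr:
  "wp (array_addr a y) (R, M) Q \<longleftrightarrow>
     Q 7 (R(rTmpB := a, rTmpA := ad (R rBase) a (R y)), M)"
proof -
  have "ad B a i = i + i + (i + i) + (i + i + (i + i)) + (i + i + (i + i) + (i + i + (i + i))) + a + B"
    for B i
    by (simp add: ad_def)
  then show ?thesis
    by (simp add: array_addr_def)
qed

lemma wp_ALoad [simp]:
  "wp (ALoad x a y) (R, M) Q \<longleftrightarrow>
     Q 8 (R(rTmpB := a, rTmpA := ad (R rBase) a (R y), x := M (ad (R rBase) a (R y))), M)"
  by (simp add: ALoad_def wp_array_addr)

lemma wp_AStore [simp]:
  "z \<noteq> rTmpA \<Longrightarrow> z \<noteq> rTmpB \<Longrightarrow> wp (AStore a y z) (R, M) Q \<longleftrightarrow>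
     Q 8 (R(rTmpB := a, rTmpA := ad (R rBase) a (R y)), M(ad (R rBase) a (R y) := R z))"
  by (simp add: AStore_def wp_array_addr)

section \<open>Counted loops\<close>

definition For :: "nat \<Rightarrow> nat \<Rightarrow> prog \<Rightarrow> prog" where
  "For i n body = Seq (Const i 0) (WhileLess i n (Seq body (Add i i rOne)))"

text \<open>Each round adds one addition and one test to the body, hence \<open>T + 2\<close>. The
  invariant must determine both the counter and the limit; on exit this forces the round index to be
  \<open>N\<close>.\<close>

lemma wp_For:
  assumes "I 0 (R(i := 0)) M"
    and I: "\<And>k R M. I k R M \<Longrightarrow> R i = k \<and> R n = N"
    and "\<And>k R M. k < N \<Longrightarrow> I k R M \<Longrightarrow>
      wp body (R, M) (\<lambda>t (R', M'). t \<le> T \<and> I (Suc k) (R'(i := R' i + R' rOne)) M')"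
  shows "wp (For i n body) (R, M) (\<lambda>t (R', M'). t \<le> N * (T + 2) + 2 \<and> I N R' M')"
proof -
  have "wp (WhileLess i n (Seq body (Add i i rOne))) (R(i := 0), M)
    (\<lambda>t (R', M'). \<exists>l. (l \<le> N \<and> I l R' M') \<and> \<not> R' i < R' n \<and> t \<le> (\<Sum>j<l. T + 1 + 1) + 1)"
  proof (rule wp_while[where N = N and T = "\<lambda>_. T + 1" and I = "\<lambda>l R M. l \<le> N \<and> I l R M"])
    show "0 \<le> N \<and> I 0 (R(i := 0)) M"
      using assms(1) by simp
  next
    fix k R M
    assume k: "k \<le> N \<and> I k R M" "R i < R n"
    then have "k < N"
      using I[of k R M] by simp
    with assms(3)[of k R M] k show "k < N \<and> wp (Seq body (Add i i rOne)) (R, M)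
        (\<lambda>t (R', M'). t \<le> T + 1 \<and> Suc k \<le> N \<and> I (Suc k) R' M')"
      by simp (rule wp_mono, assumption, simp)
  qed
  then have "wp (WhileLess i n (Seq body (Add i i rOne))) (R(i := 0), M)
    (\<lambda>t (R', M'). t \<le> N * (T + 2) + 1 \<and> I N R' M')"
  proof (rule wp_mono)
    fix t R' M'
    assume "case (R', M') of (R', M') \<Rightarrow>
      \<exists>l. (l \<le> N \<and> I l R' M') \<and> \<not> R' i < R' n \<and> t \<le> (\<Sum>j<l. T + 1 + 1) + 1"
    then obtain l where l: "l \<le> N" "I l R' M'" "\<not> R' i < R' n" "t \<le> (\<Sum>j<l. T + 1 + 1) + 1"
      by auto
    with I[of l R' M'] have "l = N"
      by simp
    with l show "case (R', M') of (R', M') \<Rightarrow> t \<le> N * (T + 2) + 1 \<and> I N R' M'"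
      by (simp add: algebra_simps)
  qed
  then show ?thesis
    unfolding For_def by simp (rule wp_mono, assumption, simp)
qed

section \<open>Exhaustive search over digit strings\<close>

definition eq_off :: "nat set \<Rightarrow> (nat \<Rightarrow> nat) \<Rightarrow> (nat \<Rightarrow> nat) \<Rightarrow> bool" where
  "eq_off X f g \<longleftrightarrow> (\<forall>x. x \<notin> X \<longrightarrow> g x = f x)"

lemma eq_offD: "eq_off X f g \<Longrightarrow> x \<notin> X \<Longrightarrow> g x = f x"
  by (simp add: eq_off_def)

lemma eq_off_refl [simp]: "eq_off X f f"
  by (simp add: eq_off_def)

lemma eq_off_upd [simp]: "x \<in> X \<Longrightarrow> eq_off X f (g(x := v)) \<longleftrightarrow> eq_off X f g"
  by (auto simp: eq_off_def)

section \<open>Digits of consecutive numbers\<close>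

definition digit :: "nat \<Rightarrow> nat \<Rightarrow> nat \<Rightarrow> nat" where
  "digit b x i = x div b ^ i mod b"

lemma digit_less: "0 < b \<Longrightarrow> digit b x i < b"
  by (simp add: digit_def)

lemma ex_number_with_digits:
  assumes "0 < b" "\<And>i. i < t \<Longrightarrow> d i < b"
  shows "\<exists>x<b ^ t. \<forall>i<t. digit b x i = d i"
  using assms(2)
proof (induction t arbitrary: d)
  case 0
  then show ?case by simp
next
  case (Suc t)
  from Suc.IH[of "\<lambda>i. d (Suc i)"] Suc.prems obtain x
    where x: "x < b ^ t" "\<forall>i<t. digit b x i = d (Suc i)"
    by auto
  have d0: "d 0 < b"
    using Suc.prems by simp
  have "d 0 + b * x < b * Suc x"
    using d0 by simp
  also have "\<dots> \<le> b * b ^ t"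
    using x(1) by (intro mult_le_mono2) simp
  finally have "d 0 + b * x < b ^ Suc t"
    by simp
  moreover have "digit b (d 0 + b * x) i = d i" if "i < Suc t" for i
    using that x(2) d0 by (cases i) (simp_all add: digit_def div_mult2_eq)
  ultimately show ?case
    by blast
qed

lemma Suc_div_power:
  assumes "0 < b"
  shows "Suc x div b ^ i = x div b ^ i + (if b ^ i dvd Suc x then 1 else 0)"
  using div_Suc[of x "b ^ i"] by (simp add: dvd_eq_mod_eq_0)

text \<open>A carry enters position \<open>i\<close> exactly if all lower digits of \<open>x\<close>
  are \<open>b - 1\<close>, that is, if \<open>b ^ i dvd Suc x\<close>. So \<open>v i\<close> is the
  digit plus the incoming carry, and the two cases show that the outgoing carry is again described
  by divisibility, now by \<open>b ^ Suc i\<close>.\<close>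

lemma digit_Suc:
  fixes b x :: nat
  assumes "0 < b"
  defines "v \<equiv> \<lambda>i. digit b x i + (if b ^ i dvd Suc x then 1 else 0)"
  shows "v i < b \<Longrightarrow> digit b (Suc x) i = v i \<and> \<not> b ^ Suc i dvd Suc x"
    and "\<not> v i < b \<Longrightarrow> digit b (Suc x) i = 0 \<and> b ^ Suc i dvd Suc x"
proof -
  define q where "q = x div b ^ i"
  have less: "q mod b < b"
    using assms(1) by simp
  have "(v i < b \<longrightarrow> digit b (Suc x) i = v i \<and> \<not> b ^ Suc i dvd Suc x) \<and>
    (\<not> v i < b \<longrightarrow> digit b (Suc x) i = 0 \<and> b ^ Suc i dvd Suc x)"
  proof (cases "b ^ i dvd Suc x")
    case True
    then obtain y where y: "Suc x = b ^ i * y" ..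
    have "Suc q = y"
      using Suc_div_power[OF assms(1), of x i] True y assms(1) by (simp add: q_def One_nat_def)
    then have "b ^ Suc i dvd Suc x \<longleftrightarrow> Suc q mod b = 0"
      using assms(1) y by (simp add: mult.commute[of b] dvd_eq_mod_eq_0)
    moreover have "v i = Suc (q mod b)"
      using True by (simp add: v_def digit_def q_def One_nat_def)
    moreover have "digit b (Suc x) i = Suc q mod b"
      using True by (simp add: digit_def Suc_div_power[OF assms(1)] q_def One_nat_def)
    ultimately show ?thesis
      using less by (simp add: mod_Suc)
  next
    case False
    then have "\<not> b ^ Suc i dvd Suc x"
      by (metis dvd_mult_right power_Suc)
    moreover have "v i = q mod b" "digit b (Suc x) i = q mod b"
      using False by (simp_all add: v_def digit_def Suc_div_power[OF assms(1)] q_def)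
    ultimately show ?thesis
      using less by simp
  qed
  then show "v i < b \<Longrightarrow> digit b (Suc x) i = v i \<and> \<not> b ^ Suc i dvd Suc x"
    and "\<not> v i < b \<Longrightarrow> digit b (Suc x) i = 0 \<and> b ^ Suc i dvd Suc x"
    by simp_all
qed

section \<open>The counter and the search loop\<close>

definition increment :: prog where
  "increment = Seq (Const rCarry 1) (For rI rT
     (Seq (ALoad rX aDig rI) (Seq (Add rX rX rCarry)
       (IfLess rX rRadix
         (Seq (AStore aDig rI rX) (Const rCarry 0))
         (AStore aDig rI rZero)))))"

text \<open>The invariant splits the string at \<open>k\<close>: positions below hold digits of
  \<open>Suc x\<close>, the others still those of \<open>x\<close>, and the carry between them is
  the divisibility from \<open>digit_Suc\<close>. All \<open>t\<close> positions are visited even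
  when the carry dies out early; the linear cost is harmless next to a pass over the conflict
  list.\<close>

lemma wp_increment:
  assumes "R rOne = 1" "R rZero = 0" "R rT = t" "R rRadix = b" "R rBase = B" "0 < b"
    and "\<And>i. i < t \<Longrightarrow> M (ad B aDig i) = digit b x i"
  shows "wp increment (R, M) (\<lambda>u (R', M'). u \<le> 24 * t + 4 \<and>
    eq_off {rTmpA, rTmpB, rCarry, rI, rX} R R' \<and> eq_off (range (ad B aDig)) M M' \<and>
    (\<forall>i<t. M' (ad B aDig i) = digit b (Suc x) i) \<and>
    R' rCarry = (if b ^ t dvd Suc x then 1 else 0))"
proof -
  define I where "I = (\<lambda>k R' M'. eq_off {rTmpA, rTmpB, rCarry, rI, rX} R R' \<and>
    eq_off (range (ad B aDig)) M M' \<and>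
    (\<forall>i<t. M' (ad B aDig i) = digit b (if i < k then Suc x else x) i) \<and> R' rI = k \<and>
    R' rCarry = (if b ^ k dvd Suc x then 1 else 0))"
  have "wp (For rI rT (Seq (ALoad rX aDig rI) (Seq (Add rX rX rCarry)
       (IfLess rX rRadix
         (Seq (AStore aDig rI rX) (Const rCarry 0))
         (AStore aDig rI rZero))))) (R(rCarry := 1), M)
     (\<lambda>u (R', M'). u \<le> t * (19 + 2) + 2 \<and> I t R' M')"
  proof (rule wp_For)
    show "I 0 (R(rCarry := 1, rI := 0)) M"
      using assms by (simp add: I_def)
  next
    fix k R' M'
    assume "I k R' M'"
    then show "R' rI = k \<and> R' rT = t"
      using assms by (auto simp: I_def eq_offD)
  next
    fix k R' M'
    assume k: "k < t" and I: "I k R' M'"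
    have fr: "R' y = R y" if "y \<notin> {rTmpA, rTmpB, rCarry, rI, rX}" for y
      using I that by (auto simp: I_def eq_offD)
    note ds = digit_Suc[OF assms(6), of x k]
    have dk: "M' (ad B aDig k) = digit b x k"
      using I k by (simp add: I_def)
    show "wp (Seq (ALoad rX aDig rI) (Seq (Add rX rX rCarry)
       (IfLess rX rRadix
         (Seq (AStore aDig rI rX) (Const rCarry 0))
         (AStore aDig rI rZero)))) (R', M')
      (\<lambda>t (R', M'). t \<le> 19 \<and> I (Suc k) (R'(rI := R' rI + R' rOne)) M')"
      using I ds k digit_less[OF assms(6)]
      by (auto simp: I_def fr assms dk less_Suc_eq digit_less)
  qed
  then show ?thesis
    unfolding increment_def wp_Seq wp_Const by (rule wp_post) (auto simp: I_def)
qed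

definition search :: "prog \<Rightarrow> prog" where
  "search p = Seq (For rI rT (AStore aDig rI rZero)) (Seq (Const rDone 0)
     (WhileLess rDone rOne (Seq p (IfLess rZero rFlag (Const rDone 1)
       (Seq increment (Move rDone rCarry))))))"

text \<open>\<open>J\<close> holds between candidates and must tolerate the advance of the counter;
  \<open>K\<close> describes what a successful candidate leaves behind and only has to survive the
  write to \<open>rDone\<close>. The summand \<open>10 * t + 4\<close> pays for zeroing the digits
  and for the setup and exit of the loop, \<open>24 * t + 8\<close> for the increment and the
  control flow of a round.\<close>

lemma wp_search:
  assumes J0: "J R M" and b: "0 < b"
    and J: "\<And>R M. J R M \<Longrightarrow> R rOne = 1 \<and> R rZero = 0 \<and> R rT = t \<and> R rRadix = b \<and> R rBase = B"
    and J_stable: "\<And>R M R' M'. J R M \<Longrightarrow> eq_off {rTmpA, rTmpB, rCarry, rI, rX, rDone} R R' \<Longrightarrow>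
      eq_off (range (ad B aDig)) M M' \<Longrightarrow> J R' M'"
    and K_stable: "\<And>R M v. K R M \<Longrightarrow> K (R(rDone := v)) M"
    and K: "\<And>R M. K R M \<Longrightarrow> R rOne = 1 \<and> R rZero = 0"
    and body: "\<And>R M d. J R M \<Longrightarrow> (\<And>i. i < t \<Longrightarrow> M (ad B aDig i) = d i) \<Longrightarrow>
      (\<And>i. d i < b) \<Longrightarrow>
      wp p (R, M) (\<lambda>u (R', M'). u \<le> T \<and> R' rFlag = (if \<phi> d then 1 else 0) \<and>
        (if \<phi> d then K R' M' else J R' M' \<and> (\<forall>i<t. M' (ad B aDig i) = d i)))"
  shows "wp (search p) (R, M) (\<lambda>u (R', M'). u \<le> b ^ t * (T + 24 * t + 8) + 10 * t + 4 \<and>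
    (if \<exists>x<b ^ t. \<phi> (digit b x) then R' rFlag = 1 \<and> K R' M' else R' rFlag = 0 \<and> J R' M'))"
proof -
  define Post where "Post = (\<lambda>R' M'.
    (if \<exists>x<b ^ t. \<phi> (digit b x) then R' rFlag = 1 \<and> K R' M' else R' rFlag = 0 \<and> J R' M'))"
  \<comment> \<open>While the loop runs, the digits spell \<open>k\<close> and all smaller numbers
    have failed. The second disjunct is entered by a success as well as by an overflow of the
    counter, since the carry is copied to \<open>rDone\<close>.\<close>
  define I where "I = (\<lambda>k R' M'.
    (R' rDone = 0 \<and> k < b ^ t \<and> J R' M' \<and> (\<forall>i<t. M' (ad B aDig i) = digit b k i) \<and>
      (\<forall>x<k. \<not> \<phi> (digit b x))) \<or> (R' rDone = 1 \<and> R' rOne = 1 \<and> k \<le> b ^ t \<and> Post R' M'))"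
  have loop: "wp (WhileLess rDone rOne (Seq p (IfLess rZero rFlag (Const rDone 1)
       (Seq increment (Move rDone rCarry))))) (R1, M1)
     (\<lambda>u (R', M'). u \<le> b ^ t * (T + 24 * t + 7 + 1) + 1 \<and> Post R' M')"
    if "I 0 R1 M1" for R1 M1
  proof (rule wp_mono, rule wp_while[where I = I and N = "b ^ t" and T = "\<lambda>_. T + 24 * t + 7"])
    show "I 0 R1 M1"
      by fact
  next
    fix k R M
    assume "I k R M" "R rDone < R rOne"
    then have k: "k < b ^ t" and JR: "J R M" and dig: "\<forall>i<t. M (ad B aDig i) = digit b k i"
      and neg: "\<forall>x<k. \<not> \<phi> (digit b x)"
      by (auto simp: I_def)
    have "wp p (R, M) (\<lambda>u (R', M'). u \<le> T \<and> R' rFlag = (if \<phi> (digit b k) then 1 else 0) \<and>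
        (if \<phi> (digit b k) then K R' M'
         else J R' M' \<and> (\<forall>i<t. M' (ad B aDig i) = digit b k i)))"
      using dig by (intro body JR digit_less[OF b]) auto
    then have "wp (Seq p (IfLess rZero rFlag (Const rDone 1)
           (Seq increment (Move rDone rCarry)))) (R, M)
          (\<lambda>u (R', M'). u \<le> T + 24 * t + 7 \<and> I (Suc k) R' M')"
      unfolding wp_Seq
    proof (rule wp_mono)
      fix u R' M'
      assume *: "case (R', M') of (R', M') \<Rightarrow> u \<le> T \<and> R' rFlag = (if \<phi> (digit b k) then 1 else 0) \<and>
        (if \<phi> (digit b k) then K R' M'
         else J R' M' \<and> (\<forall>i<t. M' (ad B aDig i) = digit b k i))"
      show "wp (IfLess rZero rFlag (Const rDone 1) (Seq increment (Move rDone rCarry))) (R', M')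
         (\<lambda>t'. (\<lambda>u (R', M'). u \<le> T + 24 * t + 7 \<and> I (Suc k) R' M') (u + t'))"
      proof (cases "\<phi> (digit b k)")
        case True
        then have "\<exists>x<b ^ t. \<phi> (digit b x)"
          using k by blast
        moreover have "K (R'(rDone := 1)) M'"
          using * True K_stable by simp
        ultimately have "Post (R'(rDone := 1)) M'"
          using * True by (simp add: Post_def)
        then show ?thesis
          using * True k K[of R' M'] by (simp add: I_def)
      next
        case False
        with * have J': "J R' M'" and flag: "R' rFlag = 0" and u: "u \<le> T"
          and dig': "\<forall>i<t. M' (ad B aDig i) = digit b k i"
          by auto
        have "wp increment (R', M') (\<lambda>u (R'', M''). u \<le> 24 * t + 4 \<and>
          eq_off {rTmpA, rTmpB, rCarry, rI, rX} R' R'' \<and> eq_off (range (ad B aDig)) M' M'' \<and>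
          (\<forall>i<t. M'' (ad B aDig i) = digit b (Suc k) i) \<and>
          R'' rCarry = (if b ^ t dvd Suc k then 1 else 0))"
          using J[OF J'] b dig' by (intro wp_increment) auto
        then have "wp increment (R', M') (\<lambda>t' (R'', M''). u + (t' + 1 + 1) \<le> T + 24 * t + 7 \<and>
          I (Suc k) (R''(rDone := R'' rCarry)) M'')"
        proof (rule wp_mono)
          fix u' R'' M''
          assume "case (R'', M'') of (R'', M'') \<Rightarrow> u' \<le> 24 * t + 4 \<and>
            eq_off {rTmpA, rTmpB, rCarry, rI, rX} R' R'' \<and> eq_off (range (ad B aDig)) M' M'' \<and>
            (\<forall>i<t. M'' (ad B aDig i) = digit b (Suc k) i) \<and>
            R'' rCarry = (if b ^ t dvd Suc k then 1 else 0)"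
          then have u': "u' \<le> 24 * t + 4"
            and fr: "eq_off {rTmpA, rTmpB, rCarry, rI, rX} R' R''" "eq_off (range (ad B aDig)) M' M''"
            and dig'': "\<forall>i<t. M'' (ad B aDig i) = digit b (Suc k) i"
            and carry: "R'' rCarry = (if b ^ t dvd Suc k then 1 else 0)"
            by auto
          have J'': "J (R''(rDone := v)) M''" for v
            using fr by (intro J_stable[OF J']) (auto simp: eq_off_def)
          have fl: "R'' rFlag = 0" "R'' rOne = 1"
            using fr flag J[OF J'] by (simp_all add: eq_offD)
          \<comment> \<open>Because \<open>k < b ^ t\<close>, a carry out of the top digit occurs
            only after the last candidate.\<close>
          have dvd: "b ^ t dvd Suc k \<longleftrightarrow> Suc k = b ^ t"
            using k by (auto dest: dvd_imp_le)
          have neg': "\<forall>x<Suc k. \<not> \<phi> (digit b x)"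
            using neg False less_Suc_eq by auto
          show "case (R'', M'') of (R'', M'') \<Rightarrow> u + (u' + 1 + 1) \<le> T + 24 * t + 7 \<and>
            I (Suc k) (R''(rDone := R'' rCarry)) M''"
          proof (cases "Suc k = b ^ t")
            case True
            then have "Post (R''(rDone := R'' rCarry)) M''"
              using neg' J'' fl by (auto simp: Post_def)
            then show ?thesis
              using u u' True fl carry by (simp add: I_def)
          next
            case False
            then have "I (Suc k) (R''(rDone := R'' rCarry)) M''"
              using neg' J'' fl carry dvd k dig'' by (auto simp: I_def)
            then show ?thesis
              using u u' by simp
          qed
        qed
        then have "wp increment (R', M') (\<lambda>t' s'. wp (Move rDone rCarry) s' (\<lambda>t''.
          (\<lambda>u (R', M'). u \<le> T + 24 * t + 7 \<and> I (Suc k) R' M') (u + (t' + t'' + 1))))"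
          by (rule wp_mono) (simp add: add.assoc)
        then show ?thesis
          using flag J[OF J'] by simp
      qed
    qed
    with k show "k < b ^ t \<and> wp (Seq p (IfLess rZero rFlag (Const rDone 1)
           (Seq increment (Move rDone rCarry)))) (R, M)
          (\<lambda>u (R', M'). u \<le> T + 24 * t + 7 \<and> I (Suc k) R' M')"
      by blast
  next
    fix u R' M'
    assume "case (R', M') of (R', M') \<Rightarrow> \<exists>l. I l R' M' \<and> \<not> R' rDone < R' rOne \<and>
       u \<le> (\<Sum>j<l. T + 24 * t + 7 + 1) + 1"
    then obtain l where l: "I l R' M'" "\<not> R' rDone < R' rOne" "u \<le> (\<Sum>j<l. T + 24 * t + 7 + 1) + 1"
      by auto
    have "R' rDone \<noteq> 0 \<or> R' rOne = 0"
      using l(2) by auto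
    with l(1) J[of R' M'] have "l \<le> b ^ t" "Post R' M'"
      by (auto simp: I_def)
    moreover have "u \<le> l * (T + 24 * t + 7 + 1) + 1"
      using l(3) by simp
    ultimately show "case (R', M') of (R', M') \<Rightarrow> u \<le> b ^ t * (T + 24 * t + 7 + 1) + 1 \<and> Post R' M'"
      by (auto elim!: order_trans intro: mult_le_mono1)
  qed
  define I0 where "I0 = (\<lambda>k R' M'. eq_off {rTmpA, rTmpB, rI} R R' \<and>
    eq_off (range (ad B aDig)) M M' \<and> (\<forall>i<k. M' (ad B aDig i) = 0) \<and> R' rI = k)"
  have "wp (For rI rT (AStore aDig rI rZero)) (R, M)
     (\<lambda>u (R', M'). u \<le> t * (8 + 2) + 2 \<and> I0 t R' M')"
  proof (rule wp_For)
    show "I0 0 (R(rI := 0)) M"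
      by (simp add: I0_def)
  next
    fix k R' M'
    assume "I0 k R' M'"
    then show "R' rI = k \<and> R' rT = t"
      using J[OF J0] by (auto simp: I0_def eq_offD)
  next
    fix k R' M'
    assume k: "k < t" and I: "I0 k R' M'"
    have fr: "R' y = R y" if "y \<notin> {rTmpA, rTmpB, rI}" for y
      using I that by (auto simp: I0_def eq_offD)
    show "wp (AStore aDig rI rZero) (R', M')
      (\<lambda>t (R', M'). t \<le> 8 \<and> I0 (Suc k) (R'(rI := R' rI + R' rOne)) M')"
      using I k J[OF J0] by (auto simp: I0_def fr less_Suc_eq)
  qed
  then show ?thesis
    unfolding search_def wp_Seq
  proof (rule wp_mono)
    fix u R' M'
    assume "case (R', M') of (R', M') \<Rightarrow> u \<le> t * (8 + 2) + 2 \<and> I0 t R' M'"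
    then have u: "u \<le> t * (8 + 2) + 2" and I0: "I0 t R' M'"
      by auto
    have "J (R'(rDone := 0)) M'"
      using I0 by (intro J_stable[OF J0]) (auto simp: eq_off_def I0_def)
    then have "I 0 (R'(rDone := 0)) M'"
      using I0 b by (auto simp: I_def I0_def digit_def)
    note loop = loop[OF this]
    show "wp (Const rDone 0) (R', M')
         (\<lambda>t' s'. wp (WhileLess rDone rOne (Seq p (IfLess rZero rFlag (Const rDone 1)
       (Seq increment (Move rDone rCarry))))) s' (\<lambda>t''.
         (\<lambda>u (R', M'). u \<le> b ^ t * (T + 24 * t + 8) + 10 * t + 4 \<and>
      (if \<exists>x<b ^ t. \<phi> (digit b x) then R' rFlag = 1 \<and> K R' M' else R' rFlag = 0 \<and> J R' M')) (u + (t' + t''))))"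
      unfolding wp_Const
    proof (rule wp_post[OF loop])
      fix v R' M'
      assume v: "v \<le> b ^ t * (T + 24 * t + 7 + 1) + 1 \<and> Post R' M'"
      have "b ^ t * (T + 24 * t + 7 + 1) = b ^ t * (T + 24 * t + 8)"
        by simp
      moreover have "t * (8 + 2) = 10 * t"
        by simp
      ultimately have "u + (1 + v) \<le> b ^ t * (T + 24 * t + 8) + 10 * t + 4"
        using u v by linarith
      with v show "case (R', M') of (R', M') \<Rightarrow>
          u + (1 + v) \<le> b ^ t * (T + 24 * t + 8) + 10 * t + 4 \<and>
          (if \<exists>x<b ^ t. \<phi> (digit b x) then R' rFlag = 1 \<and> K R' M' else R' rFlag = 0 \<and> J R' M')"
        by (simp add: Post_def)
    qed
  qed
qed

section \<open>Labelings as partial colorings of the conflict graph\<close>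

locale graph_instance =
  fixes n :: nat and E :: "nat set set" and es :: "(nat \<times> nat) list"
  assumes ugraph: "ugraph {..<n} E" and edge_list: "edge_list es E"
begin

definition m :: nat where
  "m = length es"

definition ed :: "nat \<Rightarrow> nat set" where
  "ed i = (\<lambda>(u, v). {u, v}) (es ! i)"

text \<open>The conflict graph, on the indices of the edges.\<close>

definition cf :: "nat \<Rightarrow> nat \<Rightarrow> bool" where
  "cf i j \<longleftrightarrow> i < m \<and> j < m \<and>
     (\<exists>u v w. u \<noteq> w \<and> ed i = {u, v} \<and> ed j = {v, w} \<and> {u, w} \<notin> E)"

lemma bij_ed: "bij_betw ed {..<m} E"
proof -
  have ed: "ed i = map (\<lambda>(u, v). {u, v}) es ! i" if "i < m" for i
    using that by (simp add: ed_def m_def)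
  have "inj_on ed {..<m}"
    using edge_list nth_eq_iff_index_eq[of "map (\<lambda>(u, v). {u, v}) es"]
    by (auto simp: inj_on_def ed edge_list_def m_def)
  moreover have "ed ` {..<m} = (\<lambda>i. map (\<lambda>(u, v). {u, v}) es ! i) ` {..<m}"
    by (rule image_cong) (simp_all add: ed)
  then have "ed ` {..<m} = E"
    using edge_list nth_image[of m "map (\<lambda>(u, v). {u, v}) es"]
    by (simp add: edge_list_def m_def atLeast0LessThan)
  ultimately show ?thesis
    by (simp add: bij_betw_def)
qed

lemma card_E: "card E = m"
  using bij_betw_same_card[OF bij_ed] by simp

lemma ed_in_E: "i < m \<Longrightarrow> ed i \<in> E"
  using bij_betwE[OF bij_ed] by simp

lemma ed_eq_iff: "i < m \<Longrightarrow> j < m \<Longrightarrow> ed i = ed j \<longleftrightarrow> i = j"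
  using bij_ed by (auto simp: bij_betw_def inj_on_def)

lemma edge_index: "e \<in> E \<Longrightarrow> \<exists>i<m. e = ed i"
  using bij_ed by (auto simp: bij_betw_def)

lemma cf_sym:
  assumes "cf i j"
  shows "cf j i"
proof -
  obtain u v w where "i < m" "j < m" "u \<noteq> w" "ed i = {u, v}" "ed j = {v, w}" "{u, w} \<notin> E"
    using assms unfolding cf_def by blast
  then have "w \<noteq> u \<and> ed j = {w, v} \<and> ed i = {v, u} \<and> {w, u} \<notin> E"
    by (auto simp: insert_commute)
  then show ?thesis
    using \<open>i < m\<close> \<open>j < m\<close> unfolding cf_def by blast
qed

lemma cf_irrefl: "\<not> cf i i"
  unfolding cf_def by (auto simp: doubleton_eq_iff)

text \<open>Color 0 encodes weak edges, so two conflicting edges may share it.\<close>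

definition coloring :: "nat \<Rightarrow> (nat \<Rightarrow> nat) \<Rightarrow> bool" where
  "coloring c col \<longleftrightarrow> (\<forall>i<m. col i \<le> c) \<and> (\<forall>i j. cf i j \<longrightarrow> col i = col j \<longrightarrow> col i = 0)"

definition uncolored :: "(nat \<Rightarrow> nat) \<Rightarrow> nat set" where
  "uncolored col = {i. i < m \<and> col i = 0}"

text \<open>The number of weak edges is kept exact so that the equivalence serves both the minimum
  in \<open>k1\<close> and the threshold in \<open>multi_stc\<close>.\<close>

lemma stc_labeling_iff_coloring:
  "(\<exists>S W. stc_labeling E c S W \<and> card W = k) \<longleftrightarrow>
   (\<exists>col. coloring c col \<and> card (uncolored col) = k)"
proof
  assume "\<exists>S W. stc_labeling E c S W \<and> card W = k"
  then obtain S W where stc: "stc_labeling E c S W" and W: "card W = k"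
    by blast
  have SW: "(\<Union>a\<in>{1..c}. S a) \<union> W = E" "\<And>a b. a \<in> {1..c} \<Longrightarrow> b \<in> {1..c} \<Longrightarrow> a \<noteq> b \<Longrightarrow> S a \<inter> S b = {}"
    "\<And>a. a \<in> {1..c} \<Longrightarrow> S a \<inter> W = {}"
    and no_P3: "\<And>a u v w. a \<in> {1..c} \<Longrightarrow> u \<noteq> w \<Longrightarrow> {u, v} \<in> S a \<Longrightarrow> {v, w} \<in> S a \<Longrightarrow> {u, w} \<in> E"
    using stc unfolding stc_labeling_def labeling_def disjoint_family_on_def by blast+
  define col where "col i = (if ed i \<in> W then 0 else SOME a. a \<in> {1..c} \<and> ed i \<in> S a)" for i
  have col: "col i \<in> {1..c} \<and> ed i \<in> S (col i)" if "i < m" "ed i \<notin> W" for i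
  proof -
    have "\<exists>a. a \<in> {1..c} \<and> ed i \<in> S a"
      using ed_in_E[OF that(1)] that(2) SW(1) by blast
    from someI_ex[OF this] show ?thesis
      using that by (simp add: col_def)
  qed
  have col0: "col i = 0 \<longleftrightarrow> ed i \<in> W" if "i < m" for i
    using col[OF that] by (auto simp: col_def)
  have "coloring c col"
    unfolding coloring_def
  proof (intro conjI allI impI)
    fix i assume "i < m"
    then show "col i \<le> c"
      using col[of i] by (cases "ed i \<in> W") (auto simp: col_def)
  next
    fix i j assume "cf i j" and eq: "col i = col j"
    then obtain u v w where *: "i < m" "j < m" "u \<noteq> w" "ed i = {u, v}" "ed j = {v, w}" "{u, w} \<notin> E"
      unfolding cf_def by blast
    show "col i = 0"
    proof (rule ccontr)
      assume "col i \<noteq> 0"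
      then have "col i \<in> {1..c}" "ed i \<in> S (col i)" "ed j \<in> S (col i)"
        using col[of i] col[of j] col0[OF *(1)] col0[OF *(2)] *(1,2) unfolding eq by metis+
      with no_P3[of "col i" u w v] * show False
        by simp
    qed
  qed
  moreover have "bij_betw ed (uncolored col) W"
  proof -
    have "ed ` uncolored col = W"
    proof (intro equalityI subsetI)
      fix e assume e: "e \<in> W"
      with SW(1) obtain i where "i < m" "e = ed i"
        using edge_index by blast
      with e col0 show "e \<in> ed ` uncolored col"
        by (auto simp: uncolored_def)
    qed (auto simp: uncolored_def col0)
    moreover have "inj_on ed (uncolored col)"
      by (auto simp: inj_on_def uncolored_def ed_eq_iff)
    ultimately show ?thesis
      by (simp add: bij_betw_def)
  qed
  ultimately show "\<exists>col. coloring c col \<and> card (uncolored col) = k"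
    using W bij_betw_same_card by blast
next
  assume "\<exists>col. coloring c col \<and> card (uncolored col) = k"
  then obtain col where col: "coloring c col" and k: "card (uncolored col) = k"
    by blast
  define S where "S a = ed ` {i. i < m \<and> col i = a}" for a
  define W where "W = ed ` uncolored col"
  have "labeling E c S W"
    unfolding labeling_def
  proof (intro conjI ballI)
    show "(\<Union>a\<in>{1..c}. S a) \<union> W = E"
    proof (intro equalityI subsetI)
      fix e assume "e \<in> E"
      then obtain i where i: "i < m" "e = ed i"
        using edge_index by blast
      show "e \<in> (\<Union>a\<in>{1..c}. S a) \<union> W"
      proof (cases "col i = 0")
        case True
        with i show ?thesis
          by (auto simp: W_def uncolored_def)
      next
        case False
        with i col have "col i \<in> {1..c}"
          by (simp add: coloring_def Suc_le_eq One_nat_def)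
        with i show ?thesis
          by (auto simp: S_def)
      qed
    qed (auto simp: S_def W_def uncolored_def ed_in_E)
    show "disjoint_family_on S {1..c}"
      by (auto simp: disjoint_family_on_def S_def ed_eq_iff)
    show "S a \<inter> W = {}" if "a \<in> {1..c}" for a
      using that by (auto simp: S_def W_def uncolored_def ed_eq_iff)
  qed
  moreover have "\<not> (\<exists>a\<in>{1..c}. \<exists>u v w. u \<noteq> w \<and> {u, v} \<in> S a \<and> {v, w} \<in> S a \<and> {u, w} \<notin> E)"
  proof
    assume "\<exists>a\<in>{1..c}. \<exists>u v w. u \<noteq> w \<and> {u, v} \<in> S a \<and> {v, w} \<in> S a \<and> {u, w} \<notin> E"
    then obtain a u v w where *: "a \<in> {1..c}" "u \<noteq> w" "{u, v} \<in> S a" "{v, w} \<in> S a" "{u, w} \<notin> E"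
      by blast
    then obtain i j where ij: "i < m" "j < m" "col i = a" "col j = a" "ed i = {u, v}" "ed j = {v, w}"
      by (auto simp: S_def)
    with * have "cf i j"
      by (auto simp: cf_def)
    with col ij have "a = 0"
      unfolding coloring_def by metis
    with * show False
      by simp
  qed
  ultimately have "stc_labeling E c S W"
    by (simp add: stc_labeling_def)
  moreover have "card W = k"
    unfolding W_def k[symmetric]
    by (rule card_image) (auto simp: inj_on_def uncolored_def ed_eq_iff)
  ultimately show "\<exists>S W. stc_labeling E c S W \<and> card W = k"
    by blast
qed

lemma multi_stc_iff_coloring:
  "multi_stc E c k \<longleftrightarrow> (\<exists>col. coloring c col \<and> card (uncolored col) \<le> k)"
  unfolding multi_stc_def using stc_labeling_iff_coloring by metis

section \<open>Vertex covers of the conflict graph and \<open>k1\<close>\<close>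

definition cover :: "nat set \<Rightarrow> bool" where
  "cover X \<longleftrightarrow> X \<subseteq> {..<m} \<and> (\<forall>i j. cf i j \<longrightarrow> i \<in> X \<or> j \<in> X)"

lemma finite_cover: "cover X \<Longrightarrow> finite X"
  unfolding cover_def using finite_subset by blast

lemma card_cover_le: "cover X \<Longrightarrow> card X \<le> m"
  unfolding cover_def using card_mono[of "{..<m}" X] by auto

text \<open>With a single color the strong edges are independent in the conflict graph, and the
  complement of an independent set is a vertex cover. \<open>coloring_of_cover\<close> is the way
  back.\<close>

lemma cover_uncolored: "coloring 1 col \<Longrightarrow> cover (uncolored col)"
proof -
  assume col: "coloring 1 col"
  have "i \<in> uncolored col \<or> j \<in> uncolored col" if "cf i j" for i j
  proof -
    have "i < m" "j < m"
      using that by (auto simp: cf_def)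
    moreover from this have "col i \<le> 1" "col j \<le> 1" "col i = col j \<longrightarrow> col i = 0"
      using that col unfolding coloring_def by blast+
    moreover have "col i = 1" if "col i \<noteq> 0" "col i \<le> 1" for i
      using that by simp
    ultimately show ?thesis
      unfolding uncolored_def by fastforce
  qed
  then show ?thesis
    by (auto simp: cover_def uncolored_def)
qed

lemma coloring_of_cover:
  assumes "cover X"
  defines "col \<equiv> \<lambda>i. if i \<in> X then 0 else 1"
  shows "coloring 1 col" "uncolored col = X"
  using assms by (auto simp: coloring_def uncolored_def cover_def)

lemma k1_le: "cover X \<Longrightarrow> k1 E \<le> card X"
  unfolding k1_def
  by (rule Least_le) (use stc_labeling_iff_coloring coloring_of_cover in metis)

lemma ex_cover_k1: "\<exists>X. cover X \<and> card X = k1 E"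
proof -
  \<comment> \<open>Making every edge weak is an STC-labeling, so the least value in
    \<open>k1\<close> is attained.\<close>
  have "\<exists>k. \<exists>S W. stc_labeling E 1 S W \<and> card W = k"
    unfolding stc_labeling_iff_coloring
    using coloring_of_cover(1)[of "{..<m}"] by (auto simp: cover_def cf_def)
  then have "\<exists>S W. stc_labeling E 1 S W \<and> card W = k1 E"
    unfolding k1_def by (rule LeastI_ex)
  then show ?thesis
    unfolding stc_labeling_iff_coloring using cover_uncolored by blast
qed

lemma k1_le_m: "k1 E \<le> m"
  using ex_cover_k1 card_cover_le by metis

section \<open>Colorings that extend a coloring of the cover\<close>

text \<open>A vertex cover \<open>X\<close> is given by numbering its elements: \<open>pos i\<close> is \<open>0\<close> outside of \<open>X\<close>.\<close>

definition numbering :: "nat \<Rightarrow> (nat \<Rightarrow> nat) \<Rightarrow> bool" where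
  "numbering t pos \<longleftrightarrow> cover {i. 0 < pos i} \<and> inj_on pos {i. 0 < pos i} \<and> (\<forall>i. pos i \<le> t)"

text \<open>The numbers in use are at most \<open>t < c\<close>, so color \<open>c\<close> is still
  free for the independent set outside of the cover. No edge stays weak, hence \<open>k\<close> is
  arbitrary.\<close>

lemma multi_stc_many_colors:
  assumes "numbering t pos" "t < c"
  shows "multi_stc E c k"
proof -
  define col where "col i = (if 0 < pos i then pos i else c)" for i
  have pos_less: "pos i < c" for i
    using assms le_less_trans unfolding numbering_def by blast
  have inj: "pos i = pos j \<Longrightarrow> 0 < pos i \<Longrightarrow> i = j" for i j
    using assms by (auto simp: numbering_def inj_on_def)
  have "coloring c col"
    unfolding coloring_def
  proof (intro conjI allI impI)
    fix i
    show "col i \<le> c"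
      using pos_less[of i] by (simp add: col_def)
  next
    fix i j assume ij: "cf i j" "col i = col j"
    have "pos i \<noteq> c" "pos j \<noteq> c"
      using pos_less[of i] pos_less[of j] by simp_all
    moreover have "0 < pos i \<or> 0 < pos j"
      using assms ij by (auto simp: numbering_def cover_def)
    ultimately have "i = j"
      using ij(2) inj[of i j] unfolding col_def by (simp split: if_splits)
    then show "col i = 0"
      using ij cf_irrefl by simp
  qed
  moreover have "uncolored col = {}"
    using assms by (auto simp: uncolored_def col_def)
  then have "card (uncolored col) \<le> k"
    by simp
  ultimately show ?thesis
    unfolding multi_stc_iff_coloring by blast
qed

text \<open>A digit string \<open>d\<close> colors the cover through its numbering: the element with
  number \<open>p\<close> has digit \<open>p - 1\<close>, since number 0 is reserved for edges
  outside of the cover.\<close>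

definition used :: "(nat \<Rightarrow> nat) \<Rightarrow> (nat \<Rightarrow> nat) \<Rightarrow> nat \<Rightarrow> nat set" where
  "used pos d i = {d (pos j - 1) | j. cf i j \<and> 0 < pos j \<and> 0 < d (pos j - 1)}"

definition conflict_free :: "(nat \<Rightarrow> nat) \<Rightarrow> (nat \<Rightarrow> nat) \<Rightarrow> bool" where
  "conflict_free pos d \<longleftrightarrow> (\<forall>i j. cf i j \<longrightarrow> 0 < pos i \<longrightarrow> 0 < pos j \<longrightarrow>
     d (pos i - 1) = d (pos j - 1) \<longrightarrow> d (pos i - 1) = 0)"

definition weak :: "nat \<Rightarrow> (nat \<Rightarrow> nat) \<Rightarrow> (nat \<Rightarrow> nat) \<Rightarrow> nat \<Rightarrow> bool" where
  "weak c pos d i \<longleftrightarrow> (if 0 < pos i then d (pos i - 1) = 0 else c \<le> card (used pos d i))"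

lemma finite_used: "finite (used pos d i)"
proof (rule finite_subset)
  show "used pos d i \<subseteq> (\<lambda>j. d (pos j - 1)) ` {..<m}"
    by (auto simp: used_def cf_def)
qed simp

lemma used_subset: "(\<And>i. d i \<le> c) \<Longrightarrow> used pos d i \<subseteq> {1..c}"
  by (auto simp: used_def Suc_le_eq One_nat_def)

text \<open>Once the elements of a vertex cover are colored, the remaining vertices are independent, so
  each of them can be colored greedily.\<close>

lemma multi_stc_iff_cover_coloring:
  assumes pos: "numbering t pos"
  shows "multi_stc E c k \<longleftrightarrow>
    (\<exists>d. (\<forall>i. d i \<le> c) \<and> conflict_free pos d \<and> card {i. i < m \<and> weak c pos d i} \<le> k)"
proof
  assume "multi_stc E c k"
  then obtain col where col: "coloring c col" and k: "card (uncolored col) \<le> k"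
    unfolding multi_stc_iff_coloring by blast
  define X where "X = {i. 0 < pos i}"
  \<comment> \<open>Positions that belong to no element get 0, so that \<open>d\<close> respects the
    bound \<open>c\<close> everywhere.\<close>
  define d where "d x = (if Suc x \<in> pos ` X then col (inv_into X pos (Suc x)) else 0)" for x
  have lt: "0 < pos i \<Longrightarrow> i < m" for i
    using pos by (auto simp: numbering_def cover_def)
  have d: "d (pos i - 1) = col i" if "0 < pos i" for i
  proof -
    have "inv_into X pos (pos i) = i"
      using pos that by (intro inv_into_f_f) (auto simp: numbering_def X_def)
    with that show ?thesis
      by (simp add: d_def X_def)
  qed
  have d_le: "d x \<le> c" for x
  proof (cases "Suc x \<in> pos ` X")
    case True
    then obtain i where "pos i = Suc x"
      by (metis imageE)
    then show ?thesis
      using d[of i] lt[of i] col by (auto simp: coloring_def)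
  qed (simp add: d_def)
  have "conflict_free pos d"
    using col by (auto simp: conflict_free_def d coloring_def)
  \<comment> \<open>The greedy extension leaves no more edges weak than \<open>col\<close>: if all
    \<open>c\<close> colors occur among the conflicts of an edge, \<open>col\<close> cannot color
    this edge either.\<close>
  moreover have "{i. i < m \<and> weak c pos d i} \<subseteq> uncolored col"
  proof
    fix i assume "i \<in> {i. i < m \<and> weak c pos d i}"
    then have i: "i < m" and w: "weak c pos d i"
      by auto
    show "i \<in> uncolored col"
    proof (cases "0 < pos i")
      case True
      with i w show ?thesis
        by (simp add: weak_def d uncolored_def)
    next
      case False
      with w have "card {1..c} \<le> card (used pos d i)"
        by (simp add: weak_def)
      with used_subset[of d c pos i, OF d_le] have eq: "used pos d i = {1..c}"
        by (intro card_seteq) auto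
      have "col i = 0"
      proof (rule ccontr)
        assume "col i \<noteq> 0"
        with i col have "col i \<in> used pos d i"
          unfolding eq by (simp add: coloring_def Suc_le_eq One_nat_def)
        then obtain j where "cf i j" "col i = col j"
          by (auto simp: used_def d)
        with col \<open>col i \<noteq> 0\<close> show False
          by (auto simp: coloring_def)
      qed
      with i show ?thesis
        by (simp add: uncolored_def)
    qed
  qed
  then have "card {i. i < m \<and> weak c pos d i} \<le> card (uncolored col)"
    by (rule card_mono[rotated]) (simp add: uncolored_def)
  ultimately show "\<exists>d. (\<forall>i. d i \<le> c) \<and> conflict_free pos d \<and> card {i. i < m \<and> weak c pos d i} \<le> k"
    using d_le k by (intro exI[of _ d]) simp
next
  assume "\<exists>d. (\<forall>i. d i \<le> c) \<and> conflict_free pos d \<and> card {i. i < m \<and> weak c pos d i} \<le> k"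
  then obtain d where d: "\<And>i. d i \<le> c" and free: "conflict_free pos d"
    and k: "card {i. i < m \<and> weak c pos d i} \<le> k"
    by blast
  define col where "col i = (if weak c pos d i then 0 else if 0 < pos i then d (pos i - 1)
    else SOME a. a \<in> {1..c} - used pos d i)" for i
  \<comment> \<open>An edge outside of the cover that is not weak sees fewer than \<open>c\<close>
    colors, so the choice in \<open>col\<close> is from a nonempty set.\<close>
  have fresh: "col i \<in> {1..c} - used pos d i" if "\<not> 0 < pos i" "\<not> weak c pos d i" for i
  proof -
    have "\<not> {1..c} \<subseteq> used pos d i"
      using that card_mono[OF finite_used, of "{1..c}" pos d i] by (auto simp: weak_def)
    then have "\<exists>a. a \<in> {1..c} - used pos d i"
      by blast
    from someI_ex[OF this] show ?thesis
      using that by (simp add: col_def)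
  qed
  have col_cover: "col i = d (pos i - 1)" if "0 < pos i" for i
    using that by (simp add: col_def weak_def)
  have col0: "col i = 0 \<longleftrightarrow> weak c pos d i" for i
    using fresh[of i] by (auto simp: col_def weak_def)
  have mixed: "col i = 0" if "cf i j" "col i = col j" "\<not> 0 < pos i" "0 < pos j" for i j
  proof (rule ccontr)
    assume "col i \<noteq> 0"
    then have "col i \<notin> used pos d i"
      using fresh[OF that(3)] col0[of i] by simp
    moreover have "d (pos j - 1) \<in> used pos d i"
      using that(1,2,4) \<open>col i \<noteq> 0\<close> col_cover[OF that(4)] unfolding used_def by auto
    ultimately show False
      using that(2) col_cover[OF that(4)] by simp
  qed
  have "coloring c col"
    unfolding coloring_def
  proof (intro conjI allI impI)
    fix i
    show "col i \<le> c"
      using fresh[of i] d by (cases "0 < pos i"; cases "weak c pos d i") (auto simp: col_def)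
  next
    fix i j assume ij: "cf i j" "col i = col j"
    then have "0 < pos i \<or> 0 < pos j"
      using pos by (auto simp: numbering_def cover_def)
    then consider "0 < pos i" "0 < pos j" | "\<not> 0 < pos i" "0 < pos j" | "0 < pos i" "\<not> 0 < pos j"
      by argo
    then show "col i = 0"
    proof cases
      case 1
      with free ij show ?thesis
        unfolding conflict_free_def by (metis col_cover)
    next
      case 2
      with ij show ?thesis
        by (rule mixed)
    next
      case 3
      with mixed[of j i] cf_sym ij show ?thesis
        by simp
    qed
  qed
  moreover have "uncolored col = {i. i < m \<and> weak c pos d i}"
    by (simp add: uncolored_def col0)
  ultimately show "multi_stc E c k"
    unfolding multi_stc_iff_coloring using k by auto
qed

end

section \<open>The branching scan for a vertex cover\<close>

text \<open>\<open>pos\<close> numbers the \<open>r\<close> elements chosen so far; \<open>ok\<close> records whether the budget \<open>t\<close> sufficed.\<close>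

fun scan_step :: "nat \<Rightarrow> (nat \<Rightarrow> nat) \<Rightarrow> nat \<times> nat \<Rightarrow> (nat \<Rightarrow> nat) \<times> nat \<times> bool \<Rightarrow> (nat \<Rightarrow> nat) \<times> nat \<times> bool" where
  "scan_step t d (e, f) (pos, r, ok) =
     (if 0 < pos e + pos f then (pos, r, ok)
      else if r < t then (if 0 < d r then pos(f := Suc r) else pos(e := Suc r), Suc r, ok)
      else (pos, r, False))"

definition scan :: "nat \<Rightarrow> (nat \<Rightarrow> nat) \<Rightarrow> (nat \<times> nat) list \<Rightarrow> (nat \<Rightarrow> nat) \<times> nat \<times> bool" where
  "scan t d cs = fold (scan_step t d) cs (\<lambda>_. 0, 0, True)"

definition scan_ok :: "nat \<Rightarrow> (nat \<times> nat) list \<Rightarrow> (nat \<Rightarrow> nat) \<Rightarrow> bool" where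
  "scan_ok t cs d = snd (snd (scan t d cs))"

lemma scan_snoc: "scan t d (cs @ [x]) = scan_step t d x (scan t d cs)"
  by (simp add: scan_def)

text \<open>Bit \<open>r\<close> is consulted only under the guard \<open>r < t\<close>. This makes
  the search over numbers below \<open>2 ^ t\<close> equivalent to a search over arbitrary bit
  functions.\<close>

lemma scan_cong:
  assumes "\<And>i. i < t \<Longrightarrow> d i = d' i"
  shows "scan t d cs = scan t d' cs"
proof (induction cs rule: rev_induct)
  case (snoc x cs)
  then show ?case
    unfolding scan_snoc using assms by (cases x; cases "scan t d' cs") auto
qed (simp add: scan_def)

text \<open>Soundness, whatever the bits are. A new element receives \<open>Suc r\<close>, which
  exceeds every number given before, so the numbering stays injective. Marks are never removed, so
  conflicts once covered remain covered; \<open>ok\<close> is lost as soon as one had to be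
  skipped.\<close>

lemma scan_invariant:
  assumes "scan t d cs = (pos, r, ok)"
  shows "r \<le> t \<and> (\<forall>i. pos i \<le> r) \<and> inj_on pos {i. 0 < pos i} \<and>
    {i. 0 < pos i} \<subseteq> fst ` set cs \<union> snd ` set cs \<and>
    (ok \<longrightarrow> (\<forall>(e, f)\<in>set cs. 0 < pos e \<or> 0 < pos f))"
  using assms
proof (induction cs arbitrary: pos r ok rule: rev_induct)
  case Nil
  then show ?case by (auto simp: scan_def)
next
  case (snoc x cs)
  obtain e f where x: "x = (e, f)"
    by (cases x)
  obtain pos' r' ok' where s: "scan t d cs = (pos', r', ok')"
    by (cases "scan t d cs")
  note inv = snoc.IH[OF s]
  note IH = inv[THEN conjunct1] inv[THEN conjunct2, THEN conjunct1, THEN spec]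
    inv[THEN conjunct2, THEN conjunct2, THEN conjunct1]
    inv[THEN conjunct2, THEN conjunct2, THEN conjunct2, THEN conjunct1]
  have IH_ok: "0 < pos' a \<or> 0 < pos' b" if "ok'" "(a, b) \<in> set cs" for a b
    using inv[THEN conjunct2, THEN conjunct2, THEN conjunct2, THEN conjunct2] that by auto
  \<comment> \<open>\<open>Suc r'\<close> lies above all numbers given so far, so it collides with
    none of them.\<close>
  have pick: "inj_on (pos'(y := Suc r')) {i. 0 < (pos'(y := Suc r')) i}" if "pos' y = 0" for y
  proof -
    have neq: "pos' i \<noteq> Suc r'" for i
      using IH(2)[of i] by simp
    have eq: "{i. 0 < (pos'(y := Suc r')) i} = insert y {i. 0 < pos' i}"
      by auto
    have fresh: "Suc r' \<notin> pos' ` A" for A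
      using neq by (metis imageE)
    then have "inj_on (pos'(y := Suc r')) {i. 0 < pos' i}"
      by (intro inj_on_fun_updI IH(3))
    moreover have "(pos'(y := Suc r')) y \<notin> (pos'(y := Suc r')) ` ({i. 0 < pos' i} - {y})"
      using fresh by (simp add: fun_upd_image)
    ultimately show ?thesis
      unfolding eq inj_on_insert ..
  qed
  have step: "scan_step t d (e, f) (pos', r', ok') = (pos, r, ok)"
    using snoc.prems by (simp add: scan_snoc s x)
  consider "0 < pos' e + pos' f" "pos = pos'" "r = r'" "ok = ok'"
    | y where "pos' e + pos' f = 0" "r' < t" "y = e \<or> y = f" "pos = pos'(y := Suc r')" "r = Suc r'" "ok = ok'"
    | "pos = pos'" "r = r'" "\<not> ok"
  proof (cases "0 < pos' e + pos' f")
    case True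
    then have "pos = pos' \<and> r = r' \<and> ok = ok'"
      using step by simp
    with True show ?thesis
      by (intro that(1)) simp_all
  next
    case False
    show ?thesis
    proof (cases "r' < t")
      case True
      define y where "y = (if 0 < d r' then f else e)"
      have "pos = pos'(y := Suc r') \<and> r = Suc r' \<and> ok = ok'"
        using step False True by (auto simp: y_def split: if_splits)
      with True False show ?thesis
        by (intro that(2)[of y]) (simp_all add: y_def)
    next
      case r: False
      have "pos = pos' \<and> r = r' \<and> \<not> ok"
        using step False r by simp
      then show ?thesis
        by (intro that(3)) simp_all
    qed
  qed
  then show ?case
  proof cases
    case 1
    have "ok \<longrightarrow> (\<forall>(e, f)\<in>set cs. 0 < pos e \<or> 0 < pos f)"
      using inv 1(2,4) by simp
    with 1(1,2) have "ok \<longrightarrow> (\<forall>(e, f)\<in>set (cs @ [x]). 0 < pos e \<or> 0 < pos f)"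
      by (simp add: x)
    with IH 1(2,3) show ?thesis by (auto intro: order_trans)
  next
    case 2
    then have le: "\<forall>i. pos i \<le> r"
      using IH(2) by (simp add: le_SucI)
    have inj: "inj_on pos {i. 0 < pos i}"
      using 2(1,3) pick[of y] unfolding 2(4) by blast
    have "{i. 0 < pos i} \<subseteq> insert y {i. 0 < pos' i}"
      using 2(4) by auto
    then have sub: "{i. 0 < pos i} \<subseteq> fst ` set (cs @ [x]) \<union> snd ` set (cs @ [x])"
      using 2(3) IH(4) x by auto
    have "0 < pos a \<or> 0 < pos b" if "ok" "(a, b) \<in> set cs" for a b
      using IH_ok[OF _ that(2)] that(1) 2(6) unfolding 2(4) by (auto simp: fun_upd_def)
    then have "ok \<longrightarrow> (\<forall>(e, f)\<in>set cs. 0 < pos e \<or> 0 < pos f)"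
      by (intro impI ballI case_prodI2) metis
    moreover have "0 < pos e \<or> 0 < pos f"
      using 2(3,4) by auto
    ultimately have "ok \<longrightarrow> (\<forall>(e, f)\<in>set (cs @ [x]). 0 < pos e \<or> 0 < pos f)"
      by (simp add: x)
    with le inj sub show ?thesis
      using 2(2,5) by simp
  next
    case 3
    with IH x show ?thesis by auto
  qed
qed

text \<open>A cover \<open>X\<close> dictates the bits: at each uncovered conflict an end in
  \<open>X\<close> is chosen. The marked set then stays inside \<open>X\<close>, and since each
  choice adds a new element of \<open>X\<close>, the budget \<open>t\<close> is never exhausted. The
  claim is generalized to an arbitrary intermediate state and to all \<open>d'\<close> that agree
  from \<open>r\<close> on, because earlier bits are already consumed; the induction is then free to
  prescribe bit \<open>r\<close> in front of the bits for the rest of the list.\<close>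

lemma scan_complete_aux:
  assumes X: "finite X" "card X \<le> t" "\<forall>(e, f)\<in>set cs. e \<in> X \<or> f \<in> X"
    and "{i. 0 < pos i} \<subseteq> X" "card {i. 0 < pos i} = r"
  shows "\<exists>d. (\<forall>i. d i < 2) \<and>
    (\<forall>d'. (\<forall>i\<ge>r. d' i = d i) \<longrightarrow> snd (snd (fold (scan_step t d') cs (pos, r, True))))"
  using assms(3-)
proof (induction cs arbitrary: pos r)
  case Nil
  then show ?case by (auto intro: exI[of _ "\<lambda>_. 0"])
next
  case (Cons x cs)
  obtain e f where x: "x = (e, f)"
    by (cases x)
  show ?case
  proof (cases "0 < pos e + pos f")
    case True
    with Cons.IH[of pos r] Cons.prems x show ?thesis
      by auto
  next
    case False
    define y where "y = (if e \<in> X then e else f)"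
    have y: "y \<in> X" "pos y = 0"
      using Cons.prems x False by (auto simp: y_def)
    have pos': "{i. 0 < (pos(y := Suc r)) i} = insert y {i. 0 < pos i}"
      by auto
    have fin: "finite {i. 0 < pos i}"
      using Cons.prems X finite_subset by blast
    then have card: "card (insert y {i. 0 < pos i}) = Suc r"
      using y Cons.prems by simp
    moreover have sub: "insert y {i. 0 < pos i} \<subseteq> X"
      using y Cons.prems by auto
    ultimately have "r < t"
      using card_mono[OF X(1) sub] X(2) by simp
    obtain d where d: "\<forall>i. d i < 2" "\<And>d'. \<forall>i\<ge>Suc r. d' i = d i \<Longrightarrow>
        snd (snd (fold (scan_step t d') cs (pos(y := Suc r), Suc r, True)))"
    proof -
      have "\<forall>(e, f)\<in>set cs. e \<in> X \<or> f \<in> X"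
        using Cons.prems(1) by simp
      from Cons.IH[of "pos(y := Suc r)" "Suc r", unfolded pos', OF this sub card] that
      show thesis
        by blast
    qed
    define d2 where "d2 = d(r := if e \<in> X then 0 else 1)"
    have "snd (snd (fold (scan_step t d') (x # cs) (pos, r, True)))" if "\<forall>i\<ge>r. d' i = d2 i" for d'
    proof -
      have "\<forall>i\<ge>Suc r. d' i = d i" "d' r = (if e \<in> X then 0 else 1)"
        using that by (auto simp: d2_def)
      moreover have "scan_step t d' x (pos, r, True) = (pos(y := Suc r), Suc r, True)"
        using False \<open>r < t\<close> calculation(2) by (auto simp: x y_def)
      ultimately show ?thesis
        using d(2)[of d'] by simp
    qed
    moreover have "\<forall>i. d2 i < 2"
      using d(1) by (simp add: d2_def)
    ultimately show ?thesis
      by blast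
  qed
qed

lemma scan_complete:
  assumes "finite X" "card X \<le> t" "\<forall>(e, f)\<in>set cs. e \<in> X \<or> f \<in> X"
  shows "\<exists>d. (\<forall>i. d i < 2) \<and> scan_ok t cs d"
  using scan_complete_aux[OF assms, of "\<lambda>_. 0" 0] by (auto simp: scan_ok_def scan_def)

lemma ex_digits_iff:
  assumes "0 < b" "\<And>d d'. (\<And>i. i < t \<Longrightarrow> d i = d' i) \<Longrightarrow> \<phi> d = \<phi> d'"
  shows "(\<exists>x<b ^ t. \<phi> (digit b x)) \<longleftrightarrow> (\<exists>d. (\<forall>i. d i < b) \<and> \<phi> d)"
  using assms ex_number_with_digits[OF assms(1)] digit_less[OF assms(1)] by metis

context graph_instance
begin

text \<open>A successful scan numbers a cover injectively within \<open>1..t\<close>; conversely a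
  cover of size \<open>k1 E\<close> guides a scan to success. Hence the first budget that succeeds
  is exactly \<open>k1 E\<close>.\<close>

lemma ex_scan_ok_iff:
  assumes cs: "set cs = {(i, j). cf i j}"
  shows "(\<exists>x<2 ^ t. scan_ok t cs (digit 2 x)) \<longleftrightarrow> k1 E \<le> t"
proof -
  have "(\<exists>x<2 ^ t. scan_ok t cs (digit 2 x)) \<longleftrightarrow> (\<exists>d. (\<forall>i. d i < 2) \<and> scan_ok t cs d)"
  proof (rule ex_digits_iff)
    fix d d' :: "nat \<Rightarrow> nat"
    assume "\<And>i. i < t \<Longrightarrow> d i = d' i"
    then show "scan_ok t cs d = scan_ok t cs d'"
      unfolding scan_ok_def by (simp only: scan_cong[of t d d'])
  qed simp
  also have "\<dots> \<longleftrightarrow> k1 E \<le> t"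
  proof
    assume "\<exists>d. (\<forall>i. d i < 2) \<and> scan_ok t cs d"
    then obtain d pos r where s: "scan t d cs = (pos, r, True)"
      unfolding scan_ok_def by (metis prod.collapse)
    note inv = scan_invariant[OF s]
    have X: "cover {i. 0 < pos i}"
      using inv cs by (auto simp: cover_def cf_def)
    have "pos i \<le> t" for i
      using inv le_trans by blast
    then have "pos ` {i. 0 < pos i} \<subseteq> {1..t}"
      by (auto simp: Suc_le_eq One_nat_def)
    then have "card {i. 0 < pos i} \<le> card {1..t}"
      using inv by (intro card_inj_on_le) auto
    then show "k1 E \<le> t"
      using k1_le[OF X] by simp
  next
    assume "k1 E \<le> t"
    then obtain X where X: "cover X" "card X \<le> t"
      using ex_cover_k1 by auto
    with scan_complete[of X t cs] show "\<exists>d. (\<forall>i. d i < 2) \<and> scan_ok t cs d"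
      using finite_cover cs by (auto simp: cover_def)
  qed
  finally show ?thesis .
qed

lemma numbering_scan:
  assumes cs: "set cs = {(i, j). cf i j}" and ok: "scan_ok t cs d"
  shows "numbering t (fst (scan t d cs))"
proof -
  obtain pos r where s: "scan t d cs = (pos, r, True)"
    using ok unfolding scan_ok_def by (metis prod.collapse)
  note inv = scan_invariant[OF s]
  have "cover {i. 0 < pos i}"
    using inv cs by (auto simp: cover_def cf_def)
  moreover have "pos i \<le> t" for i
    using inv le_trans by blast
  ultimately show ?thesis
    using inv s by (simp add: numbering_def)
qed

end

section \<open>The two tests on the conflict list\<close>

definition scan_body :: prog where
  "scan_body =
     Seq (ALoad rE aLE rP) (Seq (ALoad rF aLF rP)
     (Seq (ALoad rX aPos rE) (Seq (ALoad rY aPos rF) (Seq (Add rX rX rY)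
     (IfLess rZero rX Skip
       (IfLess rR rT
         (Seq (ALoad rX aDig rR) (Seq (Add rR rR rOne)
           (IfLess rZero rX (AStore aPos rF rR) (AStore aPos rE rR))))
         (Const rFlag 0)))))))"

definition scan_prog :: prog where
  "scan_prog = Seq (For rE rM (AStore aPos rE rZero)) (Seq (Const rR 0) (Seq (Const rFlag 1)
     (For rP rLen scan_body)))"

definition check_body :: prog where
  "check_body =
     Seq (ALoad rE aLE rP) (Seq (ALoad rF aLF rP) (Seq (ALoad rX aPos rF)
     (IfLess rZero rX
       (Seq (Sub rX rX rOne) (Seq (ALoad rX aDig rX)
       (IfLess rZero rX
         (Seq (ALoad rY aPos rE)
         (IfLess rZero rY
           (Seq (Sub rY rY rOne) (Seq (ALoad rY aDig rY)
             (IfLess rX rY Skip (IfLess rY rX Skip (Const rFlag 0)))))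
           (Seq (ALoad rY aRow rE) (Seq (Add rY rY rX) (Seq (ALoad rZ aSeen rY)
             (IfLess rZ rStamp
               (Seq (AStore aSeen rY rStamp) (Seq (ALoad rZ aCnt rE)
                 (Seq (Add rZ rZ rOne) (AStore aCnt rE rZ))))
               Skip))))))
         Skip)))
       Skip)))"

text \<open>In both branches \<open>rX\<close> becomes 0 exactly for weak edges: it is the digit of
  a cover element, or else the truncated difference of \<open>c\<close> and the number of distinct
  colors seen. The counter is reset on the way, ready for the next candidate.\<close>

definition count_body :: prog where
  "count_body =
     Seq (ALoad rX aPos rE)
     (Seq (IfLess rZero rX
        (Seq (Sub rX rX rOne) (ALoad rX aDig rX))
        (Seq (ALoad rX aCnt rE) (Sub rX rC rX)))
     (Seq (IfLess rZero rX Skip (Add rWeak rWeak rOne))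
     (AStore aCnt rE rZero)))"

definition check_prog :: prog where
  "check_prog = Seq (Add rStamp rStamp rOne) (Seq (Const rFlag 1) (Seq (Const rWeak 0)
     (Seq (For rP rLen check_body) (Seq (For rE rM count_body)
     (IfLess rK rWeak (Const rFlag 0) Skip)))))"

text \<open>There is no multiplication; the row with index \<open>x\<close> of a matrix starts at \<open>x * s\<close>, which is
  looked up in the array \<open>aRow\<close>.\<close>

locale conflict_list = graph_instance +
  fixes cs :: "(nat \<times> nat) list" and B c k s :: nat
  assumes set_cs: "set cs = {(i, j). cf i j}"
    and m_less_s: "m < s"
begin

definition env :: "nat \<Rightarrow> nat \<Rightarrow> (nat \<Rightarrow> nat) \<Rightarrow> (nat \<Rightarrow> nat) \<Rightarrow> bool" where
  "env t b R M \<longleftrightarrow> R rOne = 1 \<and> R rZero = 0 \<and> R rM = m \<and> R rC = c \<and> R rK = k \<and>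
     R rLen = length cs \<and> R rBase = B \<and> R rT = t \<and> R rRadix = b \<and>
     (\<forall>p<length cs. M (ad B aLE p) = fst (cs ! p) \<and> M (ad B aLF p) = snd (cs ! p)) \<and>
     (\<forall>x<m. M (ad B aRow x) = x * s)"

lemma env_upd_reg [simp]:
  "x \<notin> {rOne, rZero, rM, rC, rK, rLen, rBase, rT, rRadix} \<Longrightarrow> env t b (R(x := v)) M \<longleftrightarrow> env t b R M"
  by (auto simp: env_def)

lemma env_upd_mem [simp]:
  "a < 16 \<Longrightarrow> a \<notin> {aLE, aLF, aRow} \<Longrightarrow> env t b R (M(ad B a i := v)) \<longleftrightarrow> env t b R M"
  by (auto simp: env_def)

lemma env_stable:
  assumes "env t b R M" "eq_off {rTmpA, rTmpB, rCarry, rI, rX, rDone} R R'"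
    and "eq_off (range (ad B aDig)) M M'"
  shows "env t b R' M'"
proof -
  have R: "R' x = R x" if "x \<notin> {rTmpA, rTmpB, rCarry, rI, rX, rDone}" for x
    using assms(2) that by (rule eq_offD)
  have M: "M' (ad B a i) = M (ad B a i)" if "a < 16" "a \<noteq> aDig" for a i
    by (rule eq_offD[OF assms(3)]) (use that in auto)
  show ?thesis
    using assms(1) unfolding env_def by (simp add: R M)
qed

lemma take_Suc_snoc: "p < length cs \<Longrightarrow> take (Suc p) cs = take p cs @ [cs ! p]"
  by (simp add: take_Suc_conv_app_nth)

lemma cs_bounds: "p < length cs \<Longrightarrow> fst (cs ! p) < m \<and> snd (cs ! p) < m"
  using set_cs nth_mem[of p cs] by (auto simp: cf_def case_prod_beta)

section \<open>The cover test\<close>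

definition scan_J :: "nat \<Rightarrow> (nat \<Rightarrow> nat) \<Rightarrow> (nat \<Rightarrow> nat) \<Rightarrow> bool" where
  "scan_J t R M \<longleftrightarrow> env t 2 R M \<and> R rStamp = 0 \<and>
     (\<forall>i. M (ad B aSeen i) = 0 \<and> M (ad B aCnt i) = 0)"

lemma scan_J_upd_reg [simp]:
  "x \<notin> {rOne, rZero, rM, rC, rK, rLen, rBase, rT, rRadix, rStamp} \<Longrightarrow>
    scan_J t (R(x := v)) M \<longleftrightarrow> scan_J t R M"
  by (auto simp: scan_J_def)

lemma scan_J_upd_mem [simp]:
  "a < 16 \<Longrightarrow> a \<notin> {aLE, aLF, aRow, aSeen, aCnt} \<Longrightarrow>
    scan_J t R (M(ad B a i := v)) \<longleftrightarrow> scan_J t R M"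
  by (simp add: scan_J_def)

lemma scan_J_stable:
  assumes "scan_J t R M" "eq_off {rTmpA, rTmpB, rCarry, rI, rX, rDone} R R'"
    and "eq_off (range (ad B aDig)) M M'"
  shows "scan_J t R' M'"
proof -
  have R: "R' rStamp = R rStamp"
    by (rule eq_offD[OF assms(2)]) simp
  have M: "M' (ad B a i) = M (ad B a i)" if "a < 16" "a \<noteq> aDig" for a i
    by (rule eq_offD[OF assms(3)]) (use that in auto)
  show ?thesis
    using assms(1) env_stable[OF _ assms(2,3)] unfolding scan_J_def by (simp add: R M)
qed

lemma scan_J_D:
  assumes "scan_J t R M"
  shows "R rOne = 1" "R rZero = 0" "R rM = m" "R rLen = length cs" "R rBase = B" "R rT = t"
    "R rRadix = 2" "p < length cs \<Longrightarrow> M (ad B aLE p) = fst (cs ! p)"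
    "p < length cs \<Longrightarrow> M (ad B aLF p) = snd (cs ! p)"
  using assms by (simp_all add: scan_J_def env_def)

definition scan_K :: "nat \<Rightarrow> (nat \<Rightarrow> nat) \<Rightarrow> (nat \<Rightarrow> nat) \<Rightarrow> bool" where
  "scan_K t R M \<longleftrightarrow> scan_J t R M \<and>
     (\<exists>d. scan_ok t cs d \<and> (\<forall>i<m. M (ad B aPos i) = fst (scan t d cs) i))"

text \<open>After \<open>p\<close> rounds, \<open>aPos\<close>, \<open>rR\<close> and
  \<open>rFlag\<close> represent \<open>scan\<close> on the first \<open>p\<close> conflicts. The
  positions are cleared beforehand because the previous candidate left its own marks.
  \<open>scan_J\<close> also keeps the stamp table and the counters blank, since the coloring test
  starts from them.\<close>

lemma wp_scan_prog:
  assumes J: "scan_J t R M" and dig: "\<And>i. i < t \<Longrightarrow> M (ad B aDig i) = d i"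
  shows "wp scan_prog (R, M) (\<lambda>u (R', M'). u \<le> 60 * (m + length cs) + 6 \<and>
    R' rFlag = (if scan_ok t cs d then 1 else 0) \<and>
    (if scan_ok t cs d then scan_K t R' M'
     else scan_J t R' M' \<and> (\<forall>i<t. M' (ad B aDig i) = d i)))"
proof -
  define I0 where "I0 = (\<lambda>p R' M'. scan_J t R' M' \<and> R' rE = p \<and>
    (\<forall>i<t. M' (ad B aDig i) = d i) \<and> (\<forall>i<p. M' (ad B aPos i) = 0))"
  have loop0: "wp (For rE rM (AStore aPos rE rZero)) (R, M)
    (\<lambda>u (R', M'). u \<le> m * (8 + 2) + 2 \<and> I0 m R' M')"
  proof (rule wp_For)
    show "I0 0 (R(rE := 0)) M"
      using J dig by (simp add: I0_def)
  next
    fix p R M assume "I0 p R M"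
    then show "R rE = p \<and> R rM = m"
      by (auto simp: I0_def dest: scan_J_D)
  next
    fix p R M assume I: "I0 p R M"
    then have "scan_J t R M"
      by (simp add: I0_def)
    note D = scan_J_D[OF this]
    show "wp (AStore aPos rE rZero) (R, M)
      (\<lambda>u (R', M'). u \<le> 8 \<and> I0 (Suc p) (R'(rE := R' rE + R' rOne)) M')"
      using I by (simp add: I0_def D less_Suc_eq)
  qed
  define I where "I = (\<lambda>p R' M'. scan_J t R' M' \<and> R' rP = p \<and>
    (\<forall>i<t. M' (ad B aDig i) = d i) \<and>
    (case scan t d (take p cs) of (pos, r, ok) \<Rightarrow> (\<forall>i<m. M' (ad B aPos i) = pos i) \<and>
      R' rR = r \<and> R' rFlag = (if ok then 1 else 0)))"
  have loop: "wp (For rP rLen scan_body) (R', M')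
    (\<lambda>u (R', M'). u \<le> length cs * (54 + 2) + 2 \<and> I (length cs) R' M')"
    if "I 0 (R'(rP := 0)) M'" for R' M'
  proof (rule wp_For)
    show "I 0 (R'(rP := 0)) M'"
      by fact
  next
    fix p R M assume "I p R M"
    then show "R rP = p \<and> R rLen = length cs"
      by (auto simp: I_def dest: scan_J_D)
  next
    fix p R M assume p: "p < length cs" and I: "I p R M"
    obtain pos r ok where s: "scan t d (take p cs) = (pos, r, ok)"
      by (cases "scan t d (take p cs)")
    from I have J: "scan_J t R M"
      by (simp add: I_def)
    obtain e f where ef: "cs ! p = (e, f)"
      by (cases "cs ! p")
    note D = scan_J_D[OF J] cs_bounds[OF p]
    have I': "R rP = p" "\<And>i. i < t \<Longrightarrow> M (ad B aDig i) = d i" "\<And>i. i < m \<Longrightarrow> M (ad B aPos i) = pos i"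
      "R rR = r" "R rFlag = (if ok then 1 else 0)"
      using I by (simp_all add: I_def s)
    have step: "scan t d (take (Suc p) cs) = scan_step t d (e, f) (pos, r, ok)"
      by (simp only: take_Suc_snoc[OF p] scan_snoc s ef)
    show "wp scan_body (R, M) (\<lambda>u (R', M'). u \<le> 54 \<and> I (Suc p) (R'(rP := R' rP + R' rOne)) M')"
      unfolding I_def step scan_body_def using p J D(8,9)[OF p] D(10)
      by (simp add: D(1-7) I' ef Suc_eq_plus1[symmetric])
  qed
  show ?thesis
    unfolding scan_prog_def
  proof (rule wp_SeqI[OF loop0])
    fix u R' M'
    assume u: "u \<le> m * (8 + 2) + 2 \<and> I0 m R' M'"
    then have "I 0 (R'(rR := 0, rFlag := 1, rP := 0)) M'"
      by (simp add: I_def I0_def scan_def)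
    note w = loop[OF this]
    show "wp (Seq (Const rR 0) (Seq (Const rFlag 1) (For rP rLen scan_body))) (R', M')
      (\<lambda>t'. (\<lambda>u (R', M'). u \<le> 60 * (m + length cs) + 6 \<and>
    R' rFlag = (if scan_ok t cs d then 1 else 0) \<and>
    (if scan_ok t cs d then scan_K t R' M'
     else scan_J t R' M' \<and> (\<forall>i<t. M' (ad B aDig i) = d i))) (u + t'))"
      unfolding wp_Seq wp_Const
    proof (rule wp_post[OF w])
      fix v R' M'
      assume v: "v \<le> length cs * (54 + 2) + 2 \<and> I (length cs) R' M'"
      have "u + (1 + (1 + v)) \<le> 60 * (m + length cs) + 6"
        using u[THEN conjunct1] v[THEN conjunct1] by simp
      moreover have "R' rFlag = (if scan_ok t cs d then 1 else 0)" "scan_J t R' M'"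
        "\<forall>i<t. M' (ad B aDig i) = d i" "\<forall>i<m. M' (ad B aPos i) = fst (scan t d cs) i"
        using v by (auto simp: I_def scan_ok_def split: prod.splits)
      ultimately show "case (R', M') of (R', M') \<Rightarrow> u + (1 + (1 + v)) \<le> 60 * (m + length cs) + 6 \<and>
        R' rFlag = (if scan_ok t cs d then 1 else 0) \<and>
        (if scan_ok t cs d then scan_K t R' M'
         else scan_J t R' M' \<and> (\<forall>i<t. M' (ad B aDig i) = d i))"
        unfolding scan_K_def by auto
    qed
  qed
qed

section \<open>The coloring test\<close>

definition seen_colors :: "(nat \<Rightarrow> nat) \<Rightarrow> (nat \<Rightarrow> nat) \<Rightarrow> (nat \<times> nat) list \<Rightarrow> nat \<Rightarrow> nat set" where
  "seen_colors pos d xs e =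
     (if 0 < pos e then {} else {d (pos f - 1) | f. (e, f) \<in> set xs \<and> 0 < pos f \<and> 0 < d (pos f - 1)})"

definition no_clash :: "(nat \<Rightarrow> nat) \<Rightarrow> (nat \<Rightarrow> nat) \<Rightarrow> (nat \<times> nat) list \<Rightarrow> bool" where
  "no_clash pos d xs \<longleftrightarrow> (\<forall>(e, f)\<in>set xs. 0 < pos e \<longrightarrow> 0 < pos f \<longrightarrow>
     d (pos e - 1) = d (pos f - 1) \<longrightarrow> d (pos f - 1) = 0)"

lemma seen_colors_Nil [simp]: "seen_colors pos d [] e = {}"
  by (simp add: seen_colors_def)

lemma seen_colors_snoc: "seen_colors pos d (xs @ [(e, f)]) e' =
  (if e' = e \<and> pos e = 0 \<and> 0 < pos f \<and> 0 < d (pos f - 1)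
   then insert (d (pos f - 1)) (seen_colors pos d xs e') else seen_colors pos d xs e')"
  by (auto simp: seen_colors_def)

lemma finite_seen_colors [simp]: "finite (seen_colors pos d xs e)"
  by (induction xs rule: rev_induct) (auto simp: seen_colors_snoc)

lemma no_clash_Nil [simp]: "no_clash pos d []"
  by (simp add: no_clash_def)

lemma no_clash_snoc: "no_clash pos d (xs @ [(e, f)]) \<longleftrightarrow> no_clash pos d xs \<and>
  (0 < pos e \<longrightarrow> 0 < pos f \<longrightarrow> d (pos e - 1) = d (pos f - 1) \<longrightarrow> d (pos f - 1) = 0)"
  by (auto simp: no_clash_def)

text \<open>\<open>seen_colors\<close> and \<open>no_clash\<close> are the versions of
  \<open>used\<close> and \<open>conflict_free\<close> for a prefix of the list, as a single pass
  reveals them. On cover elements \<open>seen_colors\<close> is empty, because there the pass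
  compares colors instead of recording them.\<close>

lemma seen_colors_cs: "pos e = 0 \<Longrightarrow> seen_colors pos d cs e = used pos d e"
  by (auto simp: seen_colors_def used_def set_cs)

lemma no_clash_cs: "no_clash pos d cs \<longleftrightarrow> conflict_free pos d"
  by (auto simp: no_clash_def conflict_free_def set_cs)

text \<open>Between passes the table may hold old stamps, but none above the current one, so raising
  the stamp by one outdates them all.\<close>

definition check_J :: "nat \<Rightarrow> (nat \<Rightarrow> nat) \<Rightarrow> (nat \<Rightarrow> nat) \<Rightarrow> (nat \<Rightarrow> nat) \<Rightarrow> bool" where
  "check_J t pos R M \<longleftrightarrow> env t (Suc c) R M \<and> (\<forall>i<m. M (ad B aPos i) = pos i) \<and>
     (\<forall>i. M (ad B aSeen i) \<le> R rStamp) \<and> (\<forall>i<m. M (ad B aCnt i) = 0)"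

lemma check_J_stable:
  assumes "check_J t pos R M" "eq_off {rTmpA, rTmpB, rCarry, rI, rX, rDone} R R'"
    and "eq_off (range (ad B aDig)) M M'"
  shows "check_J t pos R' M'"
proof -
  have R: "R' rStamp = R rStamp"
    by (rule eq_offD[OF assms(2)]) simp
  have M: "M' (ad B a i) = M (ad B a i)" if "a < 16" "a \<noteq> aDig" for a i
    by (rule eq_offD[OF assms(3)]) (use that in auto)
  show ?thesis
    using assms(1) env_stable[OF _ assms(2,3)] unfolding check_J_def by (simp add: R M)
qed

lemma env_D:
  assumes "env t b R M"
  shows "R rOne = 1" "R rZero = 0" "R rM = m" "R rLen = length cs" "R rBase = B" "R rT = t"
    "R rRadix = b" "R rC = c" "R rK = k"
    "p < length cs \<Longrightarrow> M (ad B aLE p) = fst (cs ! p)"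
    "p < length cs \<Longrightarrow> M (ad B aLF p) = snd (cs ! p)"
    "x < m \<Longrightarrow> M (ad B aRow x) = x * s"
  using assms by (simp_all add: env_def)

lemma row_index_eq_iff:
  assumes "g < s" "g' < s"
  shows "x * s + g = x' * s + g' \<longleftrightarrow> x = x' \<and> g = g'"
proof
  assume eq: "x * s + g = x' * s + g'"
  have "(x * s + g) div s = x" "(x' * s + g') div s = x'"
    using assms by simp_all
  with eq have "x = x'"
    by simp
  with eq show "x = x' \<and> g = g'"
    by simp
qed simp

text \<open>The entry of the table \<open>aSeen\<close> for \<open>e\<close> and color \<open>g\<close> carries the current stamp iff \<open>g\<close>
  occurred among the conflicts of \<open>e\<close> in the current pass; stamps save clearing the table.\<close>

definition check_I :: "nat \<Rightarrow> (nat \<Rightarrow> nat) \<Rightarrow> (nat \<Rightarrow> nat) \<Rightarrow> nat \<Rightarrow> (nat \<Rightarrow> nat) \<Rightarrow> (nat \<Rightarrow> nat) \<Rightarrow> bool" where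
  "check_I t pos d p R M \<longleftrightarrow> env t (Suc c) R M \<and> (\<forall>i<m. M (ad B aPos i) = pos i) \<and>
     (\<forall>i<t. M (ad B aDig i) = d i) \<and> R rP = p \<and> R rWeak = 0 \<and>
     (\<forall>i. M (ad B aSeen i) \<le> R rStamp) \<and>
     (\<forall>e<m. \<forall>g\<le>m. M (ad B aSeen (e * s + g)) = R rStamp \<longleftrightarrow> g \<in> seen_colors pos d (take p cs) e) \<and>
     (\<forall>e<m. M (ad B aCnt e) = card (seen_colors pos d (take p cs) e)) \<and>
     R rFlag = (if no_clash pos d (take p cs) then 1 else 0)"

text \<open>Memory changes only if the conflict contributes a color that is new for
  \<open>e\<close>, and the proof splits on this. The bounds \<open>c <= t <= m < s\<close> keep
  every color inside its row, so that entries of different edges do not collide.\<close>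

lemma wp_check_body:
  assumes I: "check_I t pos d p R M" and p: "p < length cs"
    and pos: "numbering t pos" and c: "c \<le> t" "t \<le> m" and d: "\<And>i. d i \<le> c"
  shows "wp check_body (R, M) (\<lambda>u (R', M'). u \<le> 100 \<and>
    check_I t pos d (Suc p) (R'(rP := R' rP + R' rOne)) M')"
proof -
  obtain e f where ef: "cs ! p = (e, f)"
    by (cases "cs ! p")
  have em: "e < m" "f < m"
    using cs_bounds[OF p] by (simp_all add: ef)
  have env: "env t (Suc c) R M"
    using I by (simp add: check_I_def)
  note D = env_D(1-9)[OF env] env_D(10,11)[OF env p] env_D(12)[OF env em(1)]
  have I': "R rP = p" "R rWeak = 0" "\<And>i. i < t \<Longrightarrow> M (ad B aDig i) = d i" "\<And>i. i < m \<Longrightarrow> M (ad B aPos i) = pos i"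
    "R rFlag = (if no_clash pos d (take p cs) then 1 else 0)"
    "\<And>i. M (ad B aSeen i) \<le> R rStamp"
    "\<And>e g. e < m \<Longrightarrow> g \<le> m \<Longrightarrow>
       M (ad B aSeen (e * s + g)) = R rStamp \<longleftrightarrow> g \<in> seen_colors pos d (take p cs) e"
    "\<And>e. e < m \<Longrightarrow> M (ad B aCnt e) = card (seen_colors pos d (take p cs) e)"
    using I by (simp_all add: check_I_def)
  have post: "pos i - 1 < t" if "0 < pos i" for i
  proof -
    have "pos i \<le> t"
      using pos by (simp add: numbering_def)
    with that show ?thesis
      by arith
  qed
  have dm: "d i \<le> m" "d i < s" for i
    using d[of i] c m_less_s by linarith+
  have less: "M (ad B aSeen (e * s + g)) < R rStamp \<longleftrightarrow> g \<notin> seen_colors pos d (take p cs) e"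
    if "g \<le> m" for g
    using I'(6)[of "e * s + g"] I'(7)[OF em(1) that] by auto
  have row: "e' * s + g = e * s + d i \<longleftrightarrow> e' = e \<and> g = d i" if "g \<le> m" for e' g i
    using row_index_eq_iff[of g "d i" e' e] that dm m_less_s by simp
  \<comment> \<open>This covers all branches that store nothing: either no color is recorded, or the
    recorded color was seen before.\<close>
  have unch: "check_I t pos d (Suc p) (R'(rP := Suc p)) M"
    if "env t (Suc c) R' M" "R' rP = p" "R' rWeak = 0" "R' rStamp = R rStamp"
      "R' rFlag = (if no_clash pos d (take p cs) \<and>
        (0 < pos e \<longrightarrow> 0 < pos f \<longrightarrow> d (pos e - 1) = d (pos f - 1) \<longrightarrow> d (pos f - 1) = 0) then 1 else 0)"
      "\<not> (pos e = 0 \<and> 0 < pos f \<and> 0 < d (pos f - 1) \<and> d (pos f - 1) \<notin> seen_colors pos d (take p cs) e)" for R'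
    using that I' env_D(1)[OF that(1)] unfolding check_I_def take_Suc_snoc[OF p] ef seen_colors_snoc no_clash_snoc
    by (auto simp: insert_absorb)
  show ?thesis
  proof (cases "pos e = 0 \<and> 0 < pos f \<and> 0 < d (pos f - 1) \<and> d (pos f - 1) \<notin> seen_colors pos d (take p cs) e")
    case False
    then show ?thesis
      unfolding check_body_def
      using p em env by (cases "0 < pos f"; cases "0 < d (pos f - 1)"; cases "0 < pos e")
        (simp_all add: D I' ef post less dm unch Suc_eq_plus1[symmetric])
  next
    case True
    define g where "g = d (pos f - 1)"
    have g: "g \<le> m" "0 < g" "g \<notin> seen_colors pos d (take p cs) e"
      using True dm(1) by (simp_all add: g_def)
    have row: "e' * s + g' = e * s + g \<longleftrightarrow> e' = e \<and> g' = g" if "g' \<le> m" for e' g'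
      using row_index_eq_iff[of g' g e' e] that g(1) m_less_s by simp
    have seen: "seen_colors pos d (take (Suc p) cs) e' = (if e' = e
        then insert g (seen_colors pos d (take p cs) e') else seen_colors pos d (take p cs) e')" for e'
      using True by (simp add: take_Suc_snoc[OF p] ef seen_colors_snoc g_def)
    have clash: "no_clash pos d (take (Suc p) cs) = no_clash pos d (take p cs)"
      using True by (simp add: take_Suc_snoc[OF p] ef no_clash_snoc)
    have upd: "check_I t pos d (Suc p) (R'(rP := Suc p)) (M(ad B aSeen (e * s + g) := R rStamp,
          ad B aCnt e := Suc (card (seen_colors pos d (take p cs) e))))"
      if "env t (Suc c) R' M" "R' rWeak = 0" "R' rStamp = R rStamp" "R' rFlag = R rFlag" for R'
      using that g unfolding check_I_def by (simp add: seen clash I' row)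
    show ?thesis
      unfolding check_body_def
      using p em env True upd by (simp add: D I' ef post less dm Suc_eq_plus1[symmetric] g_def)
  qed
qed

lemma wp_count_body:
  assumes env: "env t (Suc c) R M" and e: "e < m" and R: "R rE = e"
    and pos: "numbering t pos" "M (ad B aPos e) = pos e"
    and dig: "\<And>i. i < t \<Longrightarrow> M (ad B aDig i) = d i"
    and cnt: "M (ad B aCnt e) = card (seen_colors pos d cs e)"
  shows "wp count_body (R, M) (\<lambda>u (R', M'). u \<le> 36 \<and>
    eq_off {rTmpA, rTmpB, rX, rWeak} R R' \<and> M' = M(ad B aCnt e := 0) \<and>
    R' rWeak = R rWeak + (if weak c pos d e then 1 else 0))"
proof -
  have post: "pos i - 1 < t" if "0 < pos i" for i
  proof -
    have "pos i \<le> t"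
      using pos by (simp add: numbering_def)
    with that show ?thesis
      by arith
  qed
  show ?thesis
    unfolding count_body_def using e post[of e] seen_colors_cs[of pos e d]
    by (cases "0 < pos e") (simp_all add: env_D[OF env] R pos dig cnt weak_def not_le)
qed

lemma card_less_Suc: "card {i. i < Suc p \<and> P i} = card {i. i < p \<and> P i} + (if P p then 1 else 0)"
proof -
  have "{i. i < Suc p \<and> P i} = (if P p then insert p {i. i < p \<and> P i} else {i. i < p \<and> P i})"
    by (auto simp: less_Suc_eq)
  then show ?thesis
    by simp
qed

definition check_ok :: "(nat \<Rightarrow> nat) \<Rightarrow> (nat \<Rightarrow> nat) \<Rightarrow> bool" where
  "check_ok pos d \<longleftrightarrow> conflict_free pos d \<and> card {i. i < m \<and> weak c pos d i} \<le> k"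

lemma wp_check_prog:
  assumes J: "check_J t pos R M" and dig: "\<And>i. i < t \<Longrightarrow> M (ad B aDig i) = d i"
    and pos: "numbering t pos" and c: "c \<le> t" "t \<le> m" and d: "\<And>i. d i < Suc c"
  shows "wp check_prog (R, M) (\<lambda>u (R', M'). u \<le> 102 * (m + length cs) + 9 \<and>
    R' rFlag = (if check_ok pos d then 1 else 0) \<and>
    check_J t pos R' M' \<and> (\<forall>i<t. M' (ad B aDig i) = d i))"
proof -
  have env0: "env t (Suc c) R M"
    using J by (simp add: check_J_def)
  have loop1: "wp (For rP rLen check_body) (R(rStamp := R rStamp + 1, rFlag := 1, rWeak := 0), M)
    (\<lambda>u (R', M'). u \<le> length cs * (100 + 2) + 2 \<and> check_I t pos d (length cs) R' M')"
  proof (rule wp_For)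
    \<comment> \<open>The new stamp exceeds every entry of the table, which therefore represents
      empty sets at the start of the pass.\<close>
    have "M (ad B aSeen i) \<noteq> R rStamp + 1" "M (ad B aSeen i) \<le> R rStamp + 1" for i
    proof -
      have "M (ad B aSeen i) \<le> R rStamp"
        using J by (simp add: check_J_def)
      then show "M (ad B aSeen i) \<noteq> R rStamp + 1" "M (ad B aSeen i) \<le> R rStamp + 1"
        by simp_all
    qed
    moreover have "env t (Suc c) (R(rStamp := v)) M" for v
      using env0 by (auto simp: env_def)
    ultimately show "check_I t pos d 0 (R(rStamp := R rStamp + 1, rFlag := 1, rWeak := 0, rP := 0)) M"
      using J dig by (simp add: check_I_def check_J_def)
  next
    fix p R M assume "check_I t pos d p R M"
    then show "R rP = p \<and> R rLen = length cs"
      by (simp add: check_I_def env_def)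
  next
    fix p R M assume "p < length cs" "check_I t pos d p R M"
    then show "wp check_body (R, M)
        (\<lambda>u (R', M'). u \<le> 100 \<and> check_I t pos d (Suc p) (R'(rP := R' rP + R' rOne)) M')"
      using pos c d by (intro wp_check_body) (auto simp: less_Suc_eq_le)
  qed
  \<comment> \<open>Counters that were already evaluated are back at 0, which restores
    \<open>check_J\<close> at the end of the pass.\<close>
  define I where "I = (\<lambda>e R' M'. env t (Suc c) R' M' \<and> (\<forall>i<m. M' (ad B aPos i) = pos i) \<and>
     (\<forall>i<t. M' (ad B aDig i) = d i) \<and> R' rE = e \<and>
     R' rWeak = card {i. i < e \<and> weak c pos d i} \<and>
     (\<forall>i. M' (ad B aSeen i) \<le> R' rStamp) \<and>
     (\<forall>i<m. M' (ad B aCnt i) = (if i < e then 0 else card (seen_colors pos d cs i))) \<and>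
     R' rFlag = (if conflict_free pos d then 1 else 0))"
  have loop2: "wp (For rE rM count_body) (R, M) (\<lambda>u (R', M'). u \<le> m * (36 + 2) + 2 \<and> I m R' M')"
    if "check_I t pos d (length cs) R M" for R M
  proof (rule wp_For)
    show "I 0 (R(rE := 0)) M"
      using that by (simp add: I_def check_I_def no_clash_cs)
  next
    fix e R M assume "I e R M"
    then show "R rE = e \<and> R rM = m"
      by (simp add: I_def env_def)
  next
    fix e R M assume e: "e < m" and I: "I e R M"
    then have env: "env t (Suc c) R M"
      by (simp add: I_def)
    have "wp count_body (R, M) (\<lambda>u (R', M'). u \<le> 36 \<and>
      eq_off {rTmpA, rTmpB, rX, rWeak} R R' \<and> M' = M(ad B aCnt e := 0) \<and>
      R' rWeak = R rWeak + (if weak c pos d e then 1 else 0))"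
      using I e by (intro wp_count_body[OF env e _ pos]) (simp_all add: I_def)
    then show "wp count_body (R, M)
        (\<lambda>u (R', M'). u \<le> 36 \<and> I (Suc e) (R'(rE := R' rE + R' rOne)) M')"
    proof (rule wp_post)
      fix u R' M'
      assume *: "u \<le> (36 :: nat) \<and> eq_off {rTmpA, rTmpB, rX, rWeak} R R' \<and> M' = M(ad B aCnt e := 0) \<and>
        R' rWeak = R rWeak + (if weak c pos d e then 1 else 0)"
      then have fr: "R' x = R x" if "x \<notin> {rTmpA, rTmpB, rX, rWeak}" for x
        using that eq_offD by blast
      have "env t (Suc c) R' M"
        using env unfolding env_def by (simp add: fr)
      moreover have "R' rWeak = card {i. i < Suc e \<and> weak c pos d i}"
        using I * by (simp add: I_def card_less_Suc)
      moreover have "i < Suc e \<longleftrightarrow> i < e" if "i \<noteq> e" for i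
        using that by auto
      ultimately show "case (R', M') of (R', M') \<Rightarrow> u \<le> 36 \<and> I (Suc e) (R'(rE := R' rE + R' rOne)) M'"
        using I * by (simp add: I_def fr env_D[OF env])
    qed
  qed
  show ?thesis
    unfolding check_prog_def wp_Seq wp_Add wp_Const
  proof (rule wp_post)
    show "wp (For rP rLen check_body) (R(rStamp := R rStamp + R rOne, rFlag := 1, rWeak := 0), M)
      (\<lambda>u (R', M'). u \<le> length cs * (100 + 2) + 2 \<and> check_I t pos d (length cs) R' M')"
      using loop1 by (simp add: env_D(1)[OF env0])
  next
    fix u R1 M1
    assume u: "u \<le> length cs * (100 + 2) + 2 \<and> check_I t pos d (length cs) R1 M1"
    note w = loop2[OF conjunct2[OF u]]
    show "wp (For rE rM count_body) (R1, M1) (\<lambda>t' s'. wp (IfLess rK rWeak (Const rFlag 0) Skip) s'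
       (\<lambda>t''. (\<lambda>u (R', M'). u \<le> 102 * (m + length cs) + 9 \<and>
    R' rFlag = (if check_ok pos d then 1 else 0) \<and>
    check_J t pos R' M' \<and> (\<forall>i<t. M' (ad B aDig i) = d i)) (1 + (1 + (1 + (u + (t' + t'')))))))"
    proof (rule wp_post[OF w])
      fix v R2 M2
      assume v: "v \<le> m * (36 + 2) + 2 \<and> I m R2 M2"
      then have env: "env t (Suc c) R2 M2"
        by (simp add: I_def)
      have le: "1 + (1 + (1 + (u + (v + 2)))) \<le> 102 * (m + length cs) + 9"
        using u[THEN conjunct1] v[THEN conjunct1] by simp
      have I: "I m R2 M2"
        using v by simp
      have "check_J t pos R2 M2" "\<And>v. check_J t pos (R2(rFlag := v)) M2" "\<forall>i<t. M2 (ad B aDig i) = d i"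
        using I by (simp_all add: I_def check_J_def)
      moreover have "R2 rFlag = (if conflict_free pos d then 1 else 0)"
        "R2 rWeak = card {i. i < m \<and> weak c pos d i}"
        using I by (simp_all add: I_def)
      ultimately show "wp (IfLess rK rWeak (Const rFlag 0) Skip) (R2, M2)
       (\<lambda>t''. (\<lambda>u (R', M'). u \<le> 102 * (m + length cs) + 9 \<and>
        R' rFlag = (if check_ok pos d then 1 else 0) \<and>
        check_J t pos R' M' \<and> (\<forall>i<t. M' (ad B aDig i) = d i)) (1 + (1 + (1 + (u + (v + t''))))))"
        using le by (simp add: env_D[OF env] check_ok_def)
    qed
  qed
qed

end

section \<open>The search for a cover and for its coloring\<close>

definition solve_prog :: prog where
  "solve_prog = Seq (Const rT 0) (Seq (Const rRadix 2) (Seq (Const rFlag 0)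
     (Seq (WhileLess rFlag rOne (Seq (search scan_prog) (IfLess rFlag rOne (Add rT rT rOne) Skip)))
     (IfLess rT rC (Const 0 1)
       (Seq (Add rRadix rC rOne) (Seq (search check_prog) (Move 0 rFlag)))))))"

text \<open>Together with the geometric sum below, this absorbs the whole cover search into the
  bound for the coloring search.\<close>

lemma two_power_le: "(2::nat) ^ k \<le> (k + 1) ^ k"
proof (cases k)
  case (Suc j)
  then show ?thesis
    by (intro power_mono) simp_all
qed simp

lemma sum_two_power_le: "(\<Sum>l<n. 2 ^ l :: nat) \<le> 2 ^ n"
  by (induction n) simp_all

context conflict_list
begin

text \<open>Digits are read only at \<open>pos j - 1\<close> for cover elements \<open>j\<close>,
  whose numbers are at most \<open>t\<close>.\<close>

lemma check_ok_cong:
  assumes "numbering t pos" "\<And>i. i < t \<Longrightarrow> d i = d' i"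
  shows "check_ok pos d = check_ok pos d'"
proof -
  have eq: "d (pos j - 1) = d' (pos j - 1)" if "0 < pos j" for j
  proof (rule assms(2))
    have "pos j \<le> t"
      using assms(1) by (simp add: numbering_def)
    with that show "pos j - 1 < t"
      by arith
  qed
  have "used pos d = used pos d'"
    unfolding used_def by (intro ext Collect_cong) (metis eq)
  then have "weak c pos d = weak c pos d'"
    by (intro ext) (simp add: weak_def eq)
  moreover have "conflict_free pos d = conflict_free pos d'"
    by (simp add: conflict_free_def eq)
  ultimately show ?thesis
    by (simp add: check_ok_def)
qed

lemma ex_check_ok_iff:
  assumes "numbering t pos"
  shows "(\<exists>x<Suc c ^ t. check_ok pos (digit (Suc c) x)) \<longleftrightarrow> multi_stc E c k"
proof -
  have "(\<exists>x<Suc c ^ t. check_ok pos (digit (Suc c) x)) \<longleftrightarrow> (\<exists>d. (\<forall>i. d i < Suc c) \<and> check_ok pos d)"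
  proof (rule ex_digits_iff)
    show "check_ok pos d = check_ok pos d'" if "\<And>i. i < t \<Longrightarrow> d i = d' i" for d d'
      using assms that by (rule check_ok_cong)
  qed simp
  also have "\<dots> \<longleftrightarrow> multi_stc E c k"
    unfolding multi_stc_iff_cover_coloring[OF assms] check_ok_def by (simp add: less_Suc_eq_le)
  finally show ?thesis .
qed

lemma scan_K_J: "scan_K t R M \<Longrightarrow> scan_J t R M"
  by (simp add: scan_K_def)

lemma wp_search_scan:
  assumes "scan_J t R M"
  shows "wp (search scan_prog) (R, M) (\<lambda>u (R', M').
    u \<le> 2 ^ t * (60 * (m + length cs) + 6 + 24 * t + 8) + 10 * t + 4 \<and>
    (if k1 E \<le> t then R' rFlag = 1 \<and> scan_K t R' M' else R' rFlag = 0 \<and> scan_J t R' M'))"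
  unfolding ex_scan_ok_iff[OF set_cs, symmetric]
proof (rule wp_search[where J = "scan_J t" and B = B])
  show "R rOne = 1 \<and> R rZero = 0 \<and> R rT = t \<and> R rRadix = 2 \<and> R rBase = B"
    if "scan_J t R M" for R M
    using scan_J_D[OF that] by simp
  show "scan_J t R' M'" if "scan_J t R M" "eq_off {rTmpA, rTmpB, rCarry, rI, rX, rDone} R R'"
      "eq_off (range (ad B aDig)) M M'" for R M R' M'
    using that by (rule scan_J_stable)
  show "scan_K t (R(rDone := v)) M" if "scan_K t R M" for R M v
    using that by (simp add: scan_K_def)
  show "R rOne = 1 \<and> R rZero = 0" if "scan_K t R M" for R M
    using scan_J_D(1,2)[OF scan_K_J[OF that]] by simp
  show "wp scan_prog (R, M) (\<lambda>u (R', M'). u \<le> 60 * (m + length cs) + 6 \<and>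
      R' rFlag = (if scan_ok t cs d then 1 else 0) \<and>
      (if scan_ok t cs d then scan_K t R' M'
       else scan_J t R' M' \<and> (\<forall>i<t. M' (ad B aDig i) = d i)))"
    if "scan_J t R M" "\<And>i. i < t \<Longrightarrow> M (ad B aDig i) = d i" for R M d
    using that by (rule wp_scan_prog)
qed (use assms in simp_all)

lemma wp_search_check:
  assumes "check_J t pos R M" "numbering t pos" "c \<le> t" "t \<le> m"
  shows "wp (search check_prog) (R, M) (\<lambda>u (R', M').
    u \<le> Suc c ^ t * (102 * (m + length cs) + 9 + 24 * t + 8) + 10 * t + 4 \<and>
    R' rFlag = (if multi_stc E c k then 1 else 0))"
proof -
  have w: "wp (search check_prog) (R, M) (\<lambda>u (R', M').
    u \<le> Suc c ^ t * (102 * (m + length cs) + 9 + 24 * t + 8) + 10 * t + 4 \<and>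
    (if \<exists>x<Suc c ^ t. check_ok pos (digit (Suc c) x)
     then R' rFlag = 1 \<and> check_J t pos R' M' else R' rFlag = 0 \<and> check_J t pos R' M'))"
  proof (rule wp_search[where J = "check_J t pos" and B = B])
    show J: "R rOne = 1 \<and> R rZero = 0 \<and> R rT = t \<and> R rRadix = Suc c \<and> R rBase = B"
      if "check_J t pos R M" for R M
      using that env_D[of t "Suc c" R M] by (simp add: check_J_def)
    show stable: "check_J t pos R' M'" if "check_J t pos R M" "eq_off {rTmpA, rTmpB, rCarry, rI, rX, rDone} R R'"
        "eq_off (range (ad B aDig)) M M'" for R M R' M'
      using that by (rule check_J_stable)
    show "check_J t pos (R(rDone := v)) M" if "check_J t pos R M" for R M v
      using that by (simp add: check_J_def)
    show "R rOne = 1 \<and> R rZero = 0" if "check_J t pos R M" for R M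
      using J[OF that] by simp
    show "wp check_prog (R, M) (\<lambda>u (R', M'). u \<le> 102 * (m + length cs) + 9 \<and>
        R' rFlag = (if check_ok pos d then 1 else 0) \<and>
        (if check_ok pos d then check_J t pos R' M'
         else check_J t pos R' M' \<and> (\<forall>i<t. M' (ad B aDig i) = d i)))"
      if "check_J t pos R M" "\<And>i. i < t \<Longrightarrow> M (ad B aDig i) = d i" "\<And>i. d i < Suc c" for R M d
      by (rule wp_post[OF wp_check_prog[OF that(1,2) assms(2-4) that(3)]]) simp_all
  qed (use assms in simp_all)
  show ?thesis
    by (rule wp_post[OF w]) (use ex_check_ok_iff[OF assms(2)] in \<open>simp split: if_splits\<close>)
qed

text \<open>Since \<open>t <= m\<close>, the cost of handling digits is charged to the pass:
  \<open>60 + 24 + 10 <= 100\<close>. In \<open>check_time\<close> the sum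
  \<open>102 + 24 + 10\<close> gives 136. The additive terms are first multiplied by the number of
  candidates, which is at least 1.\<close>

lemma scan_time:
  assumes "t \<le> m"
  shows "2 ^ t * (60 * (m + length cs) + 6 + 24 * t + 8) + 10 * t + 4 + 3 + 1
    \<le> 2 ^ t * (100 * (m + length cs + 1))"
proof -
  have "10 * t + 8 \<le> 2 ^ t * (10 * t + 8)"
    by simp
  then have "2 ^ t * (60 * (m + length cs) + 6 + 24 * t + 8) + 10 * t + 8
    \<le> 2 ^ t * (60 * (m + length cs) + 6 + 24 * t + 8 + (10 * t + 8))"
    by (simp only: distrib_left)
  also have "\<dots> \<le> 2 ^ t * (100 * (m + length cs + 1))"
    using assms by (intro mult_le_mono2) simp
  finally show ?thesis
    by simp
qed

lemma check_time:
  assumes "t \<le> m" "c \<le> t"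
  shows "Suc c ^ t * (102 * (m + length cs) + 9 + 24 * t + 8) + 10 * t + 4
    \<le> (t + 1) ^ t * (136 * (m + length cs + 1))"
proof -
  have "Suc c ^ t \<le> (t + 1) ^ t"
    using assms(2) by (intro power_mono) simp_all
  then have "Suc c ^ t * (102 * (m + length cs) + 9 + 24 * t + 8)
      \<le> (t + 1) ^ t * (102 * (m + length cs) + 9 + 24 * t + 8)"
    by (rule mult_le_mono1)
  moreover have "10 * t + 4 \<le> (t + 1) ^ t * (10 * t + 4)"
    by simp
  ultimately have "Suc c ^ t * (102 * (m + length cs) + 9 + 24 * t + 8) + 10 * t + 4
    \<le> (t + 1) ^ t * (102 * (m + length cs) + 9 + 24 * t + 8 + (10 * t + 4))"
    by (simp only: distrib_left)
  also have "\<dots> \<le> (t + 1) ^ t * (136 * (m + length cs + 1))"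
    using assms(1) by (intro mult_le_mono2) simp
  finally show ?thesis .
qed

text \<open>With \<open>A\<close> the number of candidates times the list size, the cover search
  costs \<open>200 * A\<close> by the geometric sum and the coloring search \<open>136 * A\<close>;
  the remaining constant steps fit into 350 because \<open>1 <= A\<close>.\<close>

lemma wp_solve_prog:
  assumes env: "env t0 b0 R M" and zero: "R rStamp = 0" "\<And>i. M (ad B aSeen i) = 0" "\<And>i. M (ad B aCnt i) = 0"
  shows "wp solve_prog (R, M) (\<lambda>u (R', M').
    u \<le> 350 * ((k1 E + 1) ^ k1 E * (m + length cs + 1)) \<and>
    R' 0 = (if multi_stc E c k then 1 else 0))"
proof -
  define L where "L = m + length cs + 1"
  \<comment> \<open>While the search goes on, \<open>l\<close> is the current budget; failing with
    \<open>l <= k1 E\<close> means \<open>l < k1 E\<close>, so the bound survives the increment. The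
    successful round at \<open>k1 E\<close> is counted as well, hence \<open>Suc (k1 E)\<close> on
    exit although \<open>rT\<close> stays at \<open>k1 E\<close>.\<close>
  define I where "I = (\<lambda>l R' M'. (R' rFlag = 0 \<and> scan_J l R' M' \<and> l \<le> k1 E) \<or>
    (R' rFlag = 1 \<and> l = Suc (k1 E) \<and> scan_K (k1 E) R' M'))"
  have loop: "wp (WhileLess rFlag rOne (Seq (search scan_prog) (IfLess rFlag rOne (Add rT rT rOne) Skip)))
      (R(rT := 0, rRadix := 2, rFlag := 0), M)
    (\<lambda>u (R', M'). u \<le> 2 ^ Suc (k1 E) * (100 * L) + 1 \<and> R' rFlag = 1 \<and> scan_K (k1 E) R' M')"
  proof (rule wp_post, rule wp_while[where I = I and N = "Suc (k1 E)" and
        T = "\<lambda>t. 2 ^ t * (60 * (m + length cs) + 6 + 24 * t + 8) + 10 * t + 4 + 3"])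
    show "I 0 (R(rT := 0, rRadix := 2, rFlag := 0)) M"
      using env zero by (simp add: I_def scan_J_def env_def)
  next
    fix l R M
    assume I: "I l R M" "R rFlag < R rOne"
    have "R rOne = 1" if "scan_K (k1 E) R M"
      using scan_J_D(1)[OF scan_K_J[OF that]] .
    with I have l: "l \<le> k1 E" and J: "scan_J l R M"
      by (auto simp: I_def)
    have "wp (Seq (search scan_prog) (IfLess rFlag rOne (Add rT rT rOne) Skip)) (R, M)
      (\<lambda>u (R', M'). u \<le> 2 ^ l * (60 * (m + length cs) + 6 + 24 * l + 8) + 10 * l + 4 + 3 \<and> I (Suc l) R' M')"
    proof (rule wp_SeqI[OF wp_search_scan[OF J]])
      fix u R' M'
      assume *: "u \<le> 2 ^ l * (60 * (m + length cs) + 6 + 24 * l + 8) + 10 * l + 4 \<and>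
        (if k1 E \<le> l then R' rFlag = 1 \<and> scan_K l R' M' else R' rFlag = 0 \<and> scan_J l R' M')"
      show "wp (IfLess rFlag rOne (Add rT rT rOne) Skip) (R', M')
        (\<lambda>t'. (\<lambda>u (R', M'). u \<le> 2 ^ l * (60 * (m + length cs) + 6 + 24 * l + 8) + 10 * l + 4 + 3 \<and>
          I (Suc l) R' M') (u + t'))"
      proof (cases "k1 E \<le> l")
        case True
        with l have "l = k1 E"
          by simp
        moreover have "R' rOne = 1"
          using * True scan_J_D(1)[OF scan_K_J, of l R' M'] by simp
        ultimately show ?thesis
          using * by (simp add: I_def)
      next
        case False
        with * have J': "scan_J l R' M'" "R' rFlag = 0"
          by simp_all
        then have "scan_J (Suc l) (R'(rT := Suc l)) M'"
          by (simp add: scan_J_def env_def)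
        then show ?thesis
          using * False J' scan_J_D[OF J'(1)] by (simp add: I_def Suc_eq_plus1[symmetric])
      qed
    qed
    with l show "l < Suc (k1 E) \<and> wp (Seq (search scan_prog) (IfLess rFlag rOne (Add rT rT rOne) Skip)) (R, M)
      (\<lambda>u (R', M'). u \<le> 2 ^ l * (60 * (m + length cs) + 6 + 24 * l + 8) + 10 * l + 4 + 3 \<and> I (Suc l) R' M')"
      by simp
  next
    fix u R' M'
    assume "\<exists>l. I l R' M' \<and> \<not> R' rFlag < R' rOne \<and>
      u \<le> (\<Sum>t<l. 2 ^ t * (60 * (m + length cs) + 6 + 24 * t + 8) + 10 * t + 4 + 3 + 1) + 1"
    then obtain l where l: "I l R' M'" "\<not> R' rFlag < R' rOne"
      "u \<le> (\<Sum>t<l. 2 ^ t * (60 * (m + length cs) + 6 + 24 * t + 8) + 10 * t + 4 + 3 + 1) + 1"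
      by blast
    have "R' rOne = 1" if "scan_J l R' M'"
      using that scan_J_D(1) by simp
    with l have K: "R' rFlag = 1" "l = Suc (k1 E)" "scan_K (k1 E) R' M'"
      by (auto simp: I_def)
    have "u \<le> (\<Sum>t<l. 2 ^ t * (100 * L)) + 1"
    proof (rule order_trans[OF l(3)], intro add_right_mono sum_mono)
      fix t assume "t \<in> {..<l}"
      then have "t \<le> m"
        using K(2) k1_le_m by simp
      then show "2 ^ t * (60 * (m + length cs) + 6 + 24 * t + 8) + 10 * t + 4 + 3 + 1 \<le> 2 ^ t * (100 * L)"
        unfolding L_def by (rule scan_time)
    qed
    also have "\<dots> = (\<Sum>t<l. 2 ^ t) * (100 * L) + 1"
      by (simp add: sum_distrib_right)
    also have "\<dots> \<le> 2 ^ l * (100 * L) + 1"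
      using sum_two_power_le[of l] by (intro add_right_mono mult_le_mono1)
    finally show "case (R', M') of (R', M') \<Rightarrow> u \<le> 2 ^ Suc (k1 E) * (100 * L) + 1 \<and> R' rFlag = 1 \<and> scan_K (k1 E) R' M'"
      using K by simp
  qed
  define A where "A = (k1 E + 1) ^ k1 E * L"
  have A: "2 ^ Suc (k1 E) * (100 * L) \<le> 200 * A"
    using mult_le_mono1[OF two_power_le[of "k1 E"], of L] by (simp add: A_def)
  have A1: "1 \<le> A"
    by (simp add: A_def L_def Suc_le_eq One_nat_def)
  show ?thesis
    unfolding solve_prog_def wp_Seq[of "Const _ _"] wp_Const L_def[symmetric] A_def[symmetric]
  proof (rule wp_SeqI[OF loop])
    fix u R' M'
    assume u: "u \<le> 2 ^ Suc (k1 E) * (100 * L) + 1 \<and> R' rFlag = 1 \<and> scan_K (k1 E) R' M'"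
    then have J: "scan_J (k1 E) R' M'"
      by (simp add: scan_K_def)
    then have env: "env (k1 E) 2 R' M'"
      by (simp add: scan_J_def)
    have u_le: "u \<le> 200 * A + 1"
      using u A by linarith
    from u obtain d where d: "scan_ok (k1 E) cs d" "\<forall>i<m. M' (ad B aPos i) = fst (scan (k1 E) d cs) i"
      by (auto simp: scan_K_def)
    define pos where "pos = fst (scan (k1 E) d cs)"
    have pos: "numbering (k1 E) pos"
      unfolding pos_def using set_cs d(1) by (rule numbering_scan)
    show "wp (IfLess rT rC (Const 0 1) (Seq (Add rRadix rC rOne) (Seq (search check_prog) (Move 0 rFlag)))) (R', M')
      (\<lambda>t'. (\<lambda>t'. (\<lambda>t'. (\<lambda>t'. (\<lambda>u (R', M'). u \<le> 350 * A \<and> R' 0 = (if multi_stc E c k then 1 else 0))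
        (1 + t')) (1 + t')) (1 + t')) (u + t'))"
    proof (cases "k1 E < c")
      case True
      then show ?thesis
        using multi_stc_many_colors[OF pos] u_le A1 by (simp add: env_D[OF env])
    next
      case False
      have "check_J (k1 E) pos (R'(rRadix := Suc c)) M'"
        using J d(2) by (simp add: check_J_def scan_J_def env_def pos_def)
      note w = wp_search_check[OF this pos _ k1_le_m]
      have "wp (search check_prog) (R'(rRadix := Suc c), M') (\<lambda>v (R', M'). v \<le> 136 * A \<and>
          R' rFlag = (if multi_stc E c k then 1 else 0))"
      proof (rule wp_post[OF w])
        show "c \<le> k1 E"
          using False by simp
        fix v R' M'
        assume v: "v \<le> Suc c ^ k1 E * (102 * (m + length cs) + 9 + 24 * k1 E + 8) + 10 * k1 E + 4 \<and>
          R' rFlag = (if multi_stc E c k then 1 else 0)"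
        have "v \<le> 136 * A"
          using order_trans[OF conjunct1[OF v] check_time[OF k1_le_m]] False
          by (simp only: A_def L_def mult.left_commute not_less)
        with v show "case (R', M') of (R', M') \<Rightarrow> v \<le> 136 * A \<and> R' rFlag = (if multi_stc E c k then 1 else 0)"
          by simp
      qed
      then have "wp (search check_prog) (R'(rRadix := Suc c), M') (\<lambda>v s'. wp (Move 0 rFlag) s'
          (\<lambda>v'. (\<lambda>u (R', M'). u \<le> 350 * A \<and> R' 0 = (if multi_stc E c k then 1 else 0))
            (1 + (1 + (1 + (u + (1 + (v + v') + 1)))))))"
        by (rule wp_post) (use u_le A1 in simp)
      then show ?thesis
        using False by (simp add: env_D[OF env] Suc_eq_plus1[symmetric] split del: if_split)
    qed
  qed
qed

end

section \<open>Computing the conflict list\<close>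

definition read_edge :: prog where
  "read_edge = Seq (Const rX 4) (Seq (Add rX rX rE) (Seq (Add rX rX rE)
     (Seq (Load rU rX) (Seq (Add rX rX rOne) (Load rV rX)))))"

definition rows_prog :: prog where
  "rows_prog = Seq (Const rY 0) (For rE rStride (Seq (AStore aRow rE rY) (Add rY rY rStride)))"

text \<open>Entries are edge indices plus one. Thus 0, the initial content of memory, marks
  non-edges, and the matrix is never cleared. Knowing the index, and not only adjacency, lets a
  probe name the conflicting edge in constant time.\<close>

definition adj_prog :: prog where
  "adj_prog = For rE rM (Seq read_edge (Seq (Add rZ rE rOne)
     (Seq (ALoad rX aRow rU) (Seq (Add rX rX rV) (Seq (AStore aAdj rX rZ)
     (Seq (ALoad rX aRow rV) (Seq (Add rX rX rU) (AStore aAdj rX rZ))))))))"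

text \<open>The sum of the two truncated differences is positive exactly if \<open>u\<close> and
  \<open>w\<close> differ. The case in which \<open>w\<close> equals \<open>v\<close> is rejected by
  the matrix, whose diagonal is 0.\<close>

definition probe :: "nat \<Rightarrow> nat \<Rightarrow> prog" where
  "probe u v = Seq (Sub rX u rW) (Seq (Sub rY rW u) (Seq (Add rX rX rY) (IfLess rZero rX
     (Seq (ALoad rY aRow v) (Seq (Add rY rY rW) (Seq (ALoad rF aAdj rY) (IfLess rZero rF
       (Seq (ALoad rY aRow u) (Seq (Add rY rY rW) (Seq (ALoad rX aAdj rY) (IfLess rZero rX Skip
         (Seq (Sub rF rF rOne) (Seq (AStore aLE rLen rE) (Seq (AStore aLF rLen rF)
           (Add rLen rLen rOne))))))))
       Skip))))
     Skip)))"

definition conf_prog :: prog where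
  "conf_prog = Seq (Const rLen 0) (For rE rM (Seq read_edge (For rW rN
     (Seq (probe rU rV) (probe rV rU)))))"

definition main_prog :: prog where
  "main_prog = Seq (Const rX 4) (Seq (Add rBase rX rM) (Seq (Add rBase rBase rM)
     (Seq (Add rStride rN rM) (Seq (Add rStride rStride rOne)
     (Seq rows_prog (Seq adj_prog (Seq conf_prog solve_prog)))))))"

text \<open>Graphs without edges are answered before any preparation: the bound is constant for
  them, whereas filling the table of row offsets takes time proportional to
  \<open>n\<close>.\<close>

definition multi_stc_prog :: prog where
  "multi_stc_prog = Seq (Const rOne 1) (Seq (Load rN rZero) (Seq (Load rM rOne)
     (Seq (Add rX rOne rOne) (Seq (Load rC rX) (Seq (Add rX rX rOne) (Seq (Load rK rX)
     (IfLess rZero rM main_prog (Const 0 1))))))))"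

section \<open>Memory layout\<close>

locale ram_input = graph_instance +
  fixes c k :: nat
begin

definition B :: nat where
  "B = 4 + m + m"

text \<open>One row length for both matrices: columns are vertices below \<open>n\<close> in the
  adjacency matrix and colors up to \<open>m\<close> in the table of seen colors. A single table of
  multiples of \<open>s\<close>, built by repeated addition, serves both.\<close>

definition s :: nat where
  "s = n + m + 1"

definition base :: "(nat \<Rightarrow> nat) \<Rightarrow> (nat \<Rightarrow> nat) \<Rightarrow> bool" where
  "base R M \<longleftrightarrow> R rOne = 1 \<and> R rZero = 0 \<and> R rN = n \<and> R rM = m \<and> R rC = c \<and> R rK = k \<and>
     R rBase = B \<and> R rStride = s \<and> R rStamp = 0 \<and>
     (\<forall>e<m. M (4 + e + e) = fst (es ! e) \<and> M (4 + e + e + 1) = snd (es ! e)) \<and>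
     (\<forall>i. M (ad B aSeen i) = 0 \<and> M (ad B aCnt i) = 0)"

lemma base_upd_reg [simp]:
  "x \<notin> {rOne, rZero, rN, rM, rC, rK, rBase, rStride, rStamp} \<Longrightarrow> base (R(x := v)) M \<longleftrightarrow> base R M"
  by (auto simp: base_def)

lemma base_upd_mem [simp]:
  assumes "a < 16" "a \<notin> {aSeen, aCnt}"
  shows "base R (M(ad B a i := v)) \<longleftrightarrow> base R M"
proof -
  have "4 + e + e < B" "4 + e + e + 1 < B" if "e < m" for e
    using that by (simp_all add: B_def)
  then show ?thesis
    using assms unfolding base_def by simp
qed

lemma base_D:
  assumes "base R M"
  shows "R rOne = 1" "R rZero = 0" "R rN = n" "R rM = m" "R rC = c" "R rK = k"
    "R rBase = B" "R rStride = s" "R rStamp = 0"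
  using assms by (simp_all add: base_def)

lemma wp_read_edge:
  assumes "base R M" "e < m" "R rE = e"
  shows "wp read_edge (R, M) Q \<longleftrightarrow>
    Q 6 (R(rU := fst (es ! e), rX := 4 + e + e + 1, rV := snd (es ! e)), M)"
  using assms by (simp add: read_edge_def base_def)

definition rows :: "(nat \<Rightarrow> nat) \<Rightarrow> bool" where
  "rows M \<longleftrightarrow> (\<forall>x<s. M (ad B aRow x) = x * s)"

lemma rows_upd_mem [simp]: "a < 16 \<Longrightarrow> a \<noteq> aRow \<Longrightarrow> rows (M(ad B a i := v)) \<longleftrightarrow> rows M"
  by (simp add: rows_def)

lemma rows_D: "rows M \<Longrightarrow> x < n \<Longrightarrow> M (ad B aRow x) = x * s"
  by (simp add: rows_def s_def)

lemma wp_rows_prog: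
  assumes "base R M" "\<And>i. M (ad B aAdj i) = 0"
  shows "wp rows_prog (R, M) (\<lambda>u (R', M'). u \<le> s * 11 + 3 \<and> base R' M' \<and> rows M' \<and>
    (\<forall>i. M' (ad B aAdj i) = 0))"
proof -
  define I where "I = (\<lambda>p R' M'. base R' M' \<and> R' rE = p \<and> R' rY = p * s \<and>
    (\<forall>x<p. M' (ad B aRow x) = x * s) \<and> (\<forall>i. M' (ad B aAdj i) = 0))"
  have w: "wp (For rE rStride (Seq (AStore aRow rE rY) (Add rY rY rStride))) (R(rY := 0), M)
    (\<lambda>u (R', M'). u \<le> s * (9 + 2) + 2 \<and> I s R' M')"
  proof (rule wp_For)
    show "I 0 (R(rY := 0, rE := 0)) M"
      using assms by (simp add: I_def)
  next
    fix p R M assume "I p R M"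
    then show "R rE = p \<and> R rStride = s"
      by (simp add: I_def base_def)
  next
    fix p R M assume "I p R M"
    then show "wp (Seq (AStore aRow rE rY) (Add rY rY rStride)) (R, M)
      (\<lambda>u (R', M'). u \<le> 9 \<and> I (Suc p) (R'(rE := R' rE + R' rOne)) M')"
      using base_D[of R M] by (simp add: I_def less_Suc_eq)
  qed
  show ?thesis
    unfolding rows_prog_def wp_Seq wp_Const
    by (rule wp_post[OF w]) (simp add: I_def rows_def)
qed

section \<open>The adjacency matrix of edge indices\<close>

lemma es_nth:
  assumes "e < m"
  shows "fst (es ! e) < n" "snd (es ! e) < n" "fst (es ! e) \<noteq> snd (es ! e)"
    "ed e = {fst (es ! e), snd (es ! e)}"
proof -
  show ed: "ed e = {fst (es ! e), snd (es ! e)}"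
    by (simp add: ed_def case_prod_beta)
  have "ed e \<subseteq> {..<n}" "card (ed e) = 2"
    using ugraph ed_in_E[OF assms] by (auto simp: ugraph_def)
  then show "fst (es ! e) < n" "snd (es ! e) < n" "fst (es ! e) \<noteq> snd (es ! e)"
    by (auto simp: ed)
qed

lemma index_eq_iff:
  assumes "v < n" "v' < n"
  shows "u * s + v = u' * s + v' \<longleftrightarrow> u = u' \<and> v = v'"
proof
  assume eq: "u * s + v = u' * s + v'"
  have "(u * s + v) div s = u" "(u' * s + v') div s = u'"
    using assms by (simp_all add: s_def)
  with eq have "u = u'"
    by simp
  with eq show "u = u' \<and> v = v'"
    by simp
qed simp

definition adj :: "nat \<Rightarrow> (nat \<Rightarrow> nat) \<Rightarrow> bool" where
  "adj e M \<longleftrightarrow> (\<forall>u<n. \<forall>v<n. (\<forall>i<e. ed i = {u, v} \<longrightarrow> M (ad B aAdj (u * s + v)) = Suc i) \<and>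
     ((\<forall>i<e. ed i \<noteq> {u, v}) \<longrightarrow> M (ad B aAdj (u * s + v)) = 0))"

lemma adj_upd_mem [simp]: "a < 16 \<Longrightarrow> a \<noteq> aAdj \<Longrightarrow> adj e (M(ad B a i := v)) \<longleftrightarrow> adj e M"
  by (simp add: adj_def)

text \<open>The two cells written are the two orientations of the same pair, and no two cells share
  an address because column indices stay below \<open>s\<close>. As the list names each edge once,
  no entry of an earlier edge is overwritten.\<close>

lemma adj_Suc:
  assumes "adj e M" "e < m" "es ! e = (a, b)"
  shows "adj (Suc e) (M(ad B aAdj (a * s + b) := Suc e, ad B aAdj (b * s + a) := Suc e))"
    (is "adj _ ?M")
proof -
  have ab: "a < n" "b < n" "ed e = {a, b}"
    using es_nth[OF assms(2)] assms(3) by simp_all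
  have if_or: "(if P then x else if Q then x else y) = (if Q \<or> P then x else y)" for P Q and x y :: nat
    by simp
  have M: "?M (ad B aAdj (u * s + v)) = (if {u, v} = {a, b} then Suc e else M (ad B aAdj (u * s + v)))"
    if "v < n" for u v
  proof -
    have "ad B aAdj (u * s + v) = ad B aAdj (a * s + b) \<longleftrightarrow> u = a \<and> v = b"
      "ad B aAdj (u * s + v) = ad B aAdj (b * s + a) \<longleftrightarrow> u = b \<and> v = a"
      using index_eq_iff[OF that ab(2), of u a] index_eq_iff[OF that ab(1), of u b]
      by (simp_all only: ad_def) (simp_all only: add.assoc add_left_cancel add_right_cancel mult_cancel_left, simp_all)
    then show ?thesis
      by (simp only: fun_upd_apply doubleton_eq_iff if_or)
  qed
  show ?thesis
    unfolding adj_def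
  proof (intro allI impI conjI)
    fix u v i assume uv: "u < n" "v < n" and i: "i < Suc e" "ed i = {u, v}"
    show "?M (ad B aAdj (u * s + v)) = Suc i"
    proof (cases "i = e")
      case True
      then show ?thesis
        using M[OF uv(2), of u] ab i by simp
    next
      case False
      then have "i < e" "ed i \<noteq> ed e"
        using i assms(2) ed_eq_iff[of i e] by auto
      then show ?thesis
        using M[OF uv(2), of u] ab i uv assms(1) by (simp add: adj_def)
    qed
  next
    fix u v assume uv: "u < n" "v < n" and none: "\<forall>i<Suc e. ed i \<noteq> {u, v}"
    then have "{u, v} \<noteq> {a, b}" "\<forall>i<e. ed i \<noteq> {u, v}"
      using ab by auto
    then show "?M (ad B aAdj (u * s + v)) = 0"
      using M[OF uv(2), of u] uv assms(1) by (simp add: adj_def)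
  qed
qed

lemma adj_m:
  assumes "adj m M" "u < n" "v < n"
  shows "{u, v} \<notin> E \<Longrightarrow> M (ad B aAdj (u * s + v)) = 0"
    and "j < m \<Longrightarrow> ed j = {u, v} \<Longrightarrow> M (ad B aAdj (u * s + v)) = Suc j"
proof -
  have *: "\<forall>i<m. ed i = {u, v} \<longrightarrow> M (ad B aAdj (u * s + v)) = Suc i"
    "(\<forall>i<m. ed i \<noteq> {u, v}) \<longrightarrow> M (ad B aAdj (u * s + v)) = 0"
    using assms unfolding adj_def by simp_all
  show "{u, v} \<notin> E \<Longrightarrow> M (ad B aAdj (u * s + v)) = 0"
    using *(2) ed_in_E by metis
  show "j < m \<Longrightarrow> ed j = {u, v} \<Longrightarrow> M (ad B aAdj (u * s + v)) = Suc j"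
    using *(1) by simp
qed

lemma wp_adj_prog:
  assumes "base R M" "rows M" "\<And>i. M (ad B aAdj i) = 0"
  shows "wp adj_prog (R, M) (\<lambda>u (R', M'). u \<le> m * 43 + 2 \<and> base R' M' \<and> rows M' \<and> adj m M')"
proof -
  define I where "I = (\<lambda>e R' M'. base R' M' \<and> R' rE = e \<and> rows M' \<and> adj e M')"
  have "wp adj_prog (R, M) (\<lambda>u (R', M'). u \<le> m * (41 + 2) + 2 \<and> I m R' M')"
    unfolding adj_prog_def
  proof (rule wp_For)
    show "I 0 (R(rE := 0)) M"
      using assms by (simp add: I_def adj_def)
  next
    fix e R M assume "I e R M"
    then show "R rE = e \<and> R rM = m"
      by (simp add: I_def base_def)
  next
    fix e R M assume e: "e < m" and I: "I e R M"
    obtain a b where ab: "es ! e = (a, b)"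
      by (cases "es ! e")
    have base: "base R M" "R rE = e" and rows: "rows M" and adj: "adj e M"
      using I by (simp_all add: I_def)
    note edge = es_nth[OF e, unfolded ab, simplified]
    show "wp (Seq read_edge (Seq (Add rZ rE rOne)
       (Seq (ALoad rX aRow rU) (Seq (Add rX rX rV) (Seq (AStore aAdj rX rZ)
       (Seq (ALoad rX aRow rV) (Seq (Add rX rX rU) (AStore aAdj rX rZ)))))))) (R, M)
      (\<lambda>u (R', M'). u \<le> 41 \<and> I (Suc e) (R'(rE := R' rE + R' rOne)) M')"
      using base(1) rows adj_Suc[OF adj e ab] edge
      by (simp add: wp_read_edge[OF base(1) e base(2)] ab base_D[OF base(1)] base(2) rows_D
          I_def Suc_eq_plus1[symmetric])
  qed
  then show ?thesis
    by (rule wp_post) (simp add: I_def)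
qed

section \<open>Enumerating the conflicts\<close>

definition listed :: "(nat \<times> nat) list \<Rightarrow> (nat \<Rightarrow> nat) \<Rightarrow> (nat \<Rightarrow> nat) \<Rightarrow> bool" where
  "listed L R M \<longleftrightarrow> R rLen = length L \<and>
     (\<forall>p<length L. M (ad B aLE p) = fst (L ! p) \<and> M (ad B aLF p) = snd (L ! p))"

lemma listed_snoc:
  assumes "listed L R M" "R' rLen = length L + 1"
  shows "listed (L @ [(e, f)]) R' (M(ad B aLE (length L) := e, ad B aLF (length L) := f))"
  using assms by (auto simp: listed_def nth_append less_Suc_eq)

text \<open>The pairs of conflicting edges in which \<open>e = {u, v}\<close> comes first, \<open>w\<close> is the end of the other
  edge and \<open>u\<close> is the end of \<open>e\<close> that is not shared.\<close>

definition found :: "nat \<Rightarrow> nat \<Rightarrow> nat \<Rightarrow> nat \<Rightarrow> (nat \<times> nat) set" where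
  "found e u v w = {(i, j). i = e \<and> j < m \<and> u \<noteq> w \<and> ed j = {v, w} \<and> {u, w} \<notin> E}"

definition ready :: "nat \<Rightarrow> (nat \<Rightarrow> nat) \<Rightarrow> (nat \<Rightarrow> nat) \<Rightarrow> bool" where
  "ready e R M \<longleftrightarrow> base R M \<and> rows M \<and> adj m M \<and> R rE = e"

lemma ready_upd_reg [simp]:
  "x \<notin> {rOne, rZero, rN, rM, rC, rK, rBase, rStride, rStamp, rE} \<Longrightarrow>
    ready e (R(x := v)) M \<longleftrightarrow> ready e R M"
  by (auto simp: ready_def)

lemma ready_upd_mem [simp]: "a \<in> {aLE, aLF} \<Longrightarrow> ready e R (M(ad B a i := v)) \<longleftrightarrow> ready e R M"
  by (auto simp: ready_def)

lemma listed_upd_reg [simp]: "x \<noteq> rLen \<Longrightarrow> listed L (R(x := v)) M \<longleftrightarrow> listed L R M"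
  by (simp add: listed_def)

text \<open>Three of the four outcomes leave the list alone and are settled by \<open>stop\<close>.
  In the fourth, distinct indices denote distinct edges, so the index read from the matrix is the
  only candidate and \<open>found\<close> is a singleton. The register pair is left open to cover
  both orientations of the edge.\<close>

lemma wp_probe:
  assumes ready: "ready e R M" and listed: "listed L R M"
    and uv: "(u, v) = (rU, rV) \<or> (u, v) = (rV, rU)"
    and abw: "R u = a" "R v = b" "R rW = w" "a < n" "b < n" "w < n"
  shows "wp (probe u v) (R, M) (\<lambda>t (R', M'). t \<le> 60 \<and> ready e R' M' \<and>
    R' rU = R rU \<and> R' rV = R rV \<and> R' rW = w \<and>
    (\<exists>L'. listed L' R' M' \<and> set L' = set L \<union> found e a b w \<and> length L' \<le> length L + 1))"
proof -
  have base: "base R M" and rows: "rows M" and adj: "adj m M" and e: "R rE = e"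
    using ready by (simp_all add: ready_def)
  have len: "R rLen = length L"
    using listed by (simp add: listed_def)
  note D = base_D[OF base] rows_D[OF rows] e len
  have stop: ?thesis if "found e a b w = {}" "wp (probe u v) (R, M) (\<lambda>t (R', M'). t \<le> 60 \<and>
      ready e R' M' \<and> R' rU = R rU \<and> R' rV = R rV \<and> R' rW = w \<and> listed L R' M')"
    by (rule wp_post[OF that(2)]) (use that(1) in auto)
  show ?thesis
  proof (cases "a = w")
    case True
    show ?thesis
    proof (rule stop)
      show "found e a b w = {}"
        using True by (simp add: found_def)
      show "wp (probe u v) (R, M) (\<lambda>t (R', M'). t \<le> 60 \<and>
        ready e R' M' \<and> R' rU = R rU \<and> R' rV = R rV \<and> R' rW = w \<and> listed L R' M')"
        using uv abw ready listed True unfolding probe_def by (elim disjE) (simp_all add: D)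
    qed
  next
    case neq: False
    then have neq': "0 < a - w + (w - a)"
      by linarith
    show ?thesis
    proof (cases "{b, w} \<in> E")
      case False
      note z = adj_m(1)[OF adj abw(5,6) False]
      show ?thesis
      proof (rule stop)
        show "found e a b w = {}"
        proof -
          have "ed j \<noteq> {b, w}" if "j < m" for j
            using ed_in_E[OF that] False by auto
          then show ?thesis
            by (auto simp: found_def)
        qed
        show "wp (probe u v) (R, M) (\<lambda>t (R', M'). t \<le> 60 \<and>
          ready e R' M' \<and> R' rU = R rU \<and> R' rV = R rV \<and> R' rW = w \<and> listed L R' M')"
          using uv abw ready listed neq' unfolding probe_def by (elim disjE) (simp_all add: D z)
      qed
    next
      case True
      then obtain j where j: "j < m" "ed j = {b, w}"
        using edge_index by metis
      note bw = adj_m(2)[OF adj abw(5,6) j]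
      show ?thesis
      proof (cases "{a, w} \<in> E")
        case True
        then obtain i where i: "i < m" "ed i = {a, w}"
          using edge_index by metis
        note aw = adj_m(2)[OF adj abw(4,6) i]
        show ?thesis
        proof (rule stop)
          show "found e a b w = {}"
            using True by (auto simp: found_def)
          show "wp (probe u v) (R, M) (\<lambda>t (R', M'). t \<le> 60 \<and>
            ready e R' M' \<and> R' rU = R rU \<and> R' rV = R rV \<and> R' rW = w \<and> listed L R' M')"
            using uv abw ready listed neq' unfolding probe_def by (elim disjE) (simp_all add: D bw aw)
        qed
      next
        case False
        note aw = adj_m(1)[OF adj abw(4,6) False]
        have snoc: "listed (L @ [(e, j)]) (R'(rLen := Suc (length L)))
            (M(ad B aLE (length L) := e, ad B aLF (length L) := j))" for R'
          by (rule listed_snoc[OF listed]) simp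
        have "wp (probe u v) (R, M) (\<lambda>t (R', M'). t \<le> 60 \<and>
            ready e R' M' \<and> R' rU = R rU \<and> R' rV = R rV \<and> R' rW = w \<and> listed (L @ [(e, j)]) R' M')"
          using uv abw ready listed neq' unfolding probe_def
          by (elim disjE) (simp_all add: D bw aw snoc Suc_eq_plus1[symmetric])
        moreover have "found e a b w = {(e, j)}"
          using neq False j ed_eq_iff[of j] by (auto simp: found_def)
        then have "set (L @ [(e, j)]) = set L \<union> found e a b w"
          by simp
        moreover have "length (L @ [(e, j)]) \<le> length L + 1"
          by simp
        ultimately show ?thesis
          by (elim wp_post) (simp only: prod.case, blast)
      qed
    qed
  qed
qed

definition founds :: "nat \<Rightarrow> nat \<Rightarrow> (nat \<times> nat) set" where
  "founds e w = found e (fst (es ! e)) (snd (es ! e)) w \<union> found e (snd (es ! e)) (fst (es ! e)) w"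

text \<open>An edge in conflict with \<open>i\<close> contains one end of \<open>i\<close> and is
  determined by it and by its other end \<open>w < n\<close>. Running through all \<open>w\<close>
  for both orientations of \<open>i\<close> therefore misses nothing.\<close>

lemma cf_iff_founds: "cf i j \<longleftrightarrow> i < m \<and> (\<exists>w<n. (i, j) \<in> founds i w)"
proof
  assume "cf i j"
  then obtain u v w where *: "i < m" "j < m" "u \<noteq> w" "ed i = {u, v}" "ed j = {v, w}" "{u, w} \<notin> E"
    unfolding cf_def by blast
  have "ed j \<subseteq> {..<n}"
    using ugraph ed_in_E[OF *(2)] by (auto simp: ugraph_def)
  then have "w < n"
    using *(5) by simp
  moreover have "{u, v} = {fst (es ! i), snd (es ! i)}"
    using es_nth(4)[OF *(1)] *(4) by simp
  then have "u = fst (es ! i) \<and> v = snd (es ! i) \<or> u = snd (es ! i) \<and> v = fst (es ! i)"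
    by (simp add: doubleton_eq_iff)
  then have "(i, j) \<in> founds i w"
    using *(2,3,5,6) by (auto simp: founds_def found_def)
  ultimately show "i < m \<and> (\<exists>w<n. (i, j) \<in> founds i w)"
    using *(1) by blast
next
  assume "i < m \<and> (\<exists>w<n. (i, j) \<in> founds i w)"
  then obtain w where i: "i < m" and w: "(i, j) \<in> founds i w"
    by blast
  have ed: "ed i = {fst (es ! i), snd (es ! i)}" "ed i = {snd (es ! i), fst (es ! i)}"
    using es_nth(4)[OF i] by auto
  from w show "cf i j"
    unfolding founds_def
  proof
    assume "(i, j) \<in> found i (fst (es ! i)) (snd (es ! i)) w"
    with i ed(1) show ?thesis
      unfolding cf_def found_def by blast
  next
    assume "(i, j) \<in> found i (snd (es ! i)) (fst (es ! i)) w"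
    with i ed(2) show ?thesis
      unfolding cf_def found_def by blast
  qed
qed

lemma wp_probe_both:
  assumes ready: "ready e R M" and listed: "listed L R M"
    and ab: "R rU = a" "R rV = b" "R rW = w" "a < n" "b < n" "w < n"
  shows "wp (Seq (probe rU rV) (probe rV rU)) (R, M) (\<lambda>t (R', M'). t \<le> 120 \<and> ready e R' M' \<and>
    R' rU = a \<and> R' rV = b \<and> R' rW = w \<and>
    (\<exists>L'. listed L' R' M' \<and> set L' = set L \<union> (found e a b w \<union> found e b a w) \<and>
      length L' \<le> length L + 2))"
proof (rule wp_SeqI[OF wp_probe[OF ready listed _ ab]])
  fix t R' M'
  assume *: "t \<le> (60 :: nat) \<and> ready e R' M' \<and> R' rU = R rU \<and> R' rV = R rV \<and> R' rW = w \<and>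
    (\<exists>L'. listed L' R' M' \<and> set L' = set L \<union> found e a b w \<and> length L' \<le> length L + 1)"
  then obtain L' where L': "listed L' R' M'" "set L' = set L \<union> found e a b w" "length L' \<le> length L + 1"
    by blast
  have R': "ready e R' M'" "R' rV = b" "R' rU = a" "R' rW = w" "t \<le> 60"
    using * ab by simp_all
  note w = wp_probe[OF R'(1) L'(1) _ R'(2-4) ab(5,4,6)]
  show "wp (probe rV rU) (R', M') (\<lambda>t'. (\<lambda>t (R', M'). t \<le> 120 \<and> ready e R' M' \<and>
    R' rU = a \<and> R' rV = b \<and> R' rW = w \<and>
    (\<exists>L'. listed L' R' M' \<and> set L' = set L \<union> (found e a b w \<union> found e b a w) \<and>
      length L' \<le> length L + 2)) (t + t'))"
  proof (rule wp_post[OF w])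
    fix t' R'' M''
    assume **: "t' \<le> (60 :: nat) \<and> ready e R'' M'' \<and> R'' rU = R' rU \<and> R'' rV = R' rV \<and> R'' rW = w \<and>
      (\<exists>L''. listed L'' R'' M'' \<and> set L'' = set L' \<union> found e b a w \<and> length L'' \<le> length L' + 1)"
    then obtain L'' where L'': "listed L'' R'' M''" "set L'' = set L' \<union> found e b a w" "length L'' \<le> length L' + 1"
      by blast
    have "set L'' = set L \<union> (found e a b w \<union> found e b a w)" "length L'' \<le> length L + 2"
      using L' L'' by auto
    with ** R' L''(1) show "case (R'', M'') of (R', M') \<Rightarrow> t + t' \<le> 120 \<and> ready e R' M' \<and>
      R' rU = a \<and> R' rV = b \<and> R' rW = w \<and>
      (\<exists>L'. listed L' R' M' \<and> set L' = set L \<union> (found e a b w \<union> found e b a w) \<and>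
        length L' \<le> length L + 2)"
      by simp blast
  qed simp
qed simp

lemma wp_conf_prog:
  assumes "base R M" "rows M" "adj m M"
  shows "wp conf_prog (R, M) (\<lambda>u (R', M'). u \<le> m * (n * 122 + 10) + 3 \<and> base R' M' \<and> rows M' \<and>
    (\<exists>L. listed L R' M' \<and> set L = {(i, j). cf i j} \<and> length L \<le> 2 * n * m))"
proof -
  have inner: "wp (For rW rN (Seq (probe rU rV) (probe rV rU))) (R, M)
    (\<lambda>u (R', M'). u \<le> n * (120 + 2) + 2 \<and> ready e R' M' \<and>
      (\<exists>L'. listed L' R' M' \<and> set L' = set L \<union> (\<Union>w<n. founds e w) \<and> length L' \<le> length L + 2 * n))"
    if "ready e R M" "listed L R M" "R rU = fst (es ! e)" "R rV = snd (es ! e)" "e < m" for e L R M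
  proof -
    define I where "I = (\<lambda>p R' M'. ready e R' M' \<and> R' rU = fst (es ! e) \<and> R' rV = snd (es ! e) \<and>
      R' rW = p \<and>
      (\<exists>L'. listed L' R' M' \<and> set L' = set L \<union> (\<Union>w<p. founds e w) \<and> length L' \<le> length L + 2 * p))"
    have w: "wp (For rW rN (Seq (probe rU rV) (probe rV rU))) (R, M)
      (\<lambda>u (R', M'). u \<le> n * (120 + 2) + 2 \<and> I n R' M')"
    proof (rule wp_For)
      show "I 0 (R(rW := 0)) M"
        using that by (auto simp: I_def)
    next
      fix p R M assume "I p R M"
      then show "R rW = p \<and> R rN = n"
        by (simp add: I_def ready_def base_def)
    next
      fix p R M assume p: "p < n" and I: "I p R M"
      then obtain L' where L': "listed L' R M" "set L' = set L \<union> (\<Union>w<p. founds e w)"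
          "length L' \<le> length L + 2 * p"
        by (auto simp: I_def)
      have ready: "ready e R M" "R rU = fst (es ! e)" "R rV = snd (es ! e)" "R rW = p"
        using I by (simp_all add: I_def)
      note w = wp_probe_both[OF ready(1) L'(1) ready(2-4) es_nth(1,2)[OF that(5)] p]
      show "wp (Seq (probe rU rV) (probe rV rU)) (R, M)
        (\<lambda>u (R', M'). u \<le> 120 \<and> I (Suc p) (R'(rW := R' rW + R' rOne)) M')"
      proof (rule wp_post[OF w], unfold founds_def[symmetric])
        fix u R' M'
        assume *: "u \<le> (120 :: nat) \<and> ready e R' M' \<and> R' rU = fst (es ! e) \<and> R' rV = snd (es ! e) \<and>
          R' rW = p \<and> (\<exists>L''. listed L'' R' M' \<and> set L'' = set L' \<union> founds e p \<and> length L'' \<le> length L' + 2)"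
        then obtain L'' where L'': "listed L'' R' M'" "set L'' = set L' \<union> founds e p" "length L'' \<le> length L' + 2"
          by blast
        have "set L'' = set L \<union> (\<Union>w<Suc p. founds e w)" "length L'' \<le> length L + 2 * Suc p"
          using L' L'' by (auto simp: lessThan_Suc)
        with * L''(1) show "case (R', M') of (R', M') \<Rightarrow> u \<le> 120 \<and> I (Suc p) (R'(rW := R' rW + R' rOne)) M'"
          by (auto simp: I_def ready_def base_def)
      qed
    qed
    show ?thesis
      by (rule wp_post[OF w]) (simp add: I_def)
  qed
  \<comment> \<open>Two probes per edge and vertex, each appending at most one pair, account for
    \<open>2 * n * e\<close>.\<close>
  define I where "I = (\<lambda>e R' M'. ready e R' M' \<and>
    (\<exists>L. listed L R' M' \<and> set L = (\<Union>i<e. \<Union>w<n. founds i w) \<and> length L \<le> 2 * n * e))"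
  have "wp (For rE rM (Seq read_edge (For rW rN (Seq (probe rU rV) (probe rV rU))))) (R(rLen := 0), M)
    (\<lambda>u (R', M'). u \<le> m * ((n * 122 + 8) + 2) + 2 \<and> I m R' M')"
  proof (rule wp_For)
    show "I 0 (R(rLen := 0, rE := 0)) M"
      using assms by (auto simp: I_def ready_def listed_def)
  next
    fix e R M assume "I e R M"
    then show "R rE = e \<and> R rM = m"
      by (simp add: I_def ready_def base_def)
  next
    fix e R M assume e: "e < m" and I: "I e R M"
    then obtain L where L: "listed L R M" "set L = (\<Union>i<e. \<Union>w<n. founds i w)" "length L \<le> 2 * n * e"
      by (auto simp: I_def)
    have ready: "ready e R M" "base R M" "R rE = e"
      using I by (simp_all add: I_def ready_def)
    define R1 where "R1 = R(rU := fst (es ! e), rX := 4 + e + e + 1, rV := snd (es ! e))"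
    have "wp (For rW rN (Seq (probe rU rV) (probe rV rU))) (R1, M)
      (\<lambda>u (R', M'). u \<le> n * (120 + 2) + 2 \<and> ready e R' M' \<and>
      (\<exists>L'. listed L' R' M' \<and> set L' = set L \<union> (\<Union>w<n. founds e w) \<and> length L' \<le> length L + 2 * n))"
      by (rule inner) (use ready L e in \<open>simp_all add: R1_def\<close>)
    then have "wp (For rW rN (Seq (probe rU rV) (probe rV rU))) (R1, M)
      (\<lambda>u. (\<lambda>u (R', M'). u \<le> n * 122 + 8 \<and> I (Suc e) (R'(rE := R' rE + R' rOne)) M') (6 + u))"
    proof (rule wp_post)
      fix u R' M'
      assume *: "u \<le> n * (120 + 2) + 2 \<and> ready e R' M' \<and>
        (\<exists>L'. listed L' R' M' \<and> set L' = set L \<union> (\<Union>w<n. founds e w) \<and> length L' \<le> length L + 2 * n)"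
      then obtain L' where L': "listed L' R' M'" "set L' = set L \<union> (\<Union>w<n. founds e w)" "length L' \<le> length L + 2 * n"
        by blast
      have "set L' = (\<Union>i<Suc e. \<Union>w<n. founds i w)"
        using L(2) L'(2) by (simp add: lessThan_Suc Un_commute)
      moreover have "length L' \<le> 2 * n * Suc e"
        using L(3) L'(3) by simp
      moreover have "ready (Suc e) (R'(rE := R' rE + R' rOne)) M'"
        using * by (auto simp: ready_def base_def)
      moreover have "listed L' (R'(rE := R' rE + R' rOne)) M'"
        using L'(1) by simp
      moreover have "6 + u \<le> n * 122 + 8"
        using * by simp
      ultimately show "case (R', M') of (R', M') \<Rightarrow> 6 + u \<le> n * 122 + 8 \<and> I (Suc e) (R'(rE := R' rE + R' rOne)) M'"
        unfolding I_def by blast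
    qed
    then show "wp (Seq read_edge (For rW rN (Seq (probe rU rV) (probe rV rU)))) (R, M)
      (\<lambda>u (R', M'). u \<le> n * 122 + 8 \<and> I (Suc e) (R'(rE := R' rE + R' rOne)) M')"
      by (simp only: wp_Seq wp_read_edge[OF ready(2) e ready(3)] R1_def)
  qed
  then show ?thesis
    unfolding conf_prog_def wp_Seq[of "Const _ _"] wp_Const
  proof (rule wp_post)
    fix u R' M'
    assume u: "u \<le> m * ((n * 122 + 8) + 2) + 2 \<and> I m R' M'"
    have "(\<Union>i<m. \<Union>w<n. founds i w) = {(i, j). cf i j}"
    proof -
      have "fst x = i" if "x \<in> founds i w" for x i w
        using that by (auto simp: founds_def found_def)
      then show ?thesis
        unfolding cf_iff_founds by fastforce
    qed
    with u show "case (R', M') of (R', M') \<Rightarrow> 1 + u \<le> m * (n * 122 + 10) + 3 \<and> base R' M' \<and> rows M' \<and>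
      (\<exists>L. listed L R' M' \<and> set L = {(i, j). cf i j} \<and> length L \<le> 2 * n * m)"
      by (simp add: I_def ready_def add.commute[of 10])
  qed
qed

section \<open>Total running time\<close>

lemma wp_rest:
  assumes "base R M" "rows M" "listed L R M" "set L = {(i, j). cf i j}" "length L \<le> 2 * n * m"
  shows "wp solve_prog (R, M) (\<lambda>u (R', M').
    u \<le> 350 * ((k1 E + 1) ^ k1 E * (m + 2 * n * m + 1)) \<and>
    R' 0 = (if multi_stc E c k then 1 else 0))"
proof -
  interpret conflict_list n E es L B c k s
    by unfold_locales (use assms(4) in \<open>simp_all add: s_def\<close>)
  have "\<forall>x<m. M (ad B aRow x) = x * s"
    using assms(2) by (simp add: rows_def s_def)
  \<comment> \<open>\<open>solve_prog\<close> sets budget and radix itself, so whatever these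
    registers contain at this point will do.\<close>
  then have "env (R rT) (R rRadix) R M"
    using assms(1,3) by (simp add: env_def base_def listed_def)
  then have w: "wp solve_prog (R, M) (\<lambda>u (R', M').
    u \<le> 350 * ((k1 E + 1) ^ k1 E * (m + length L + 1)) \<and>
    R' 0 = (if multi_stc E c k then 1 else 0))"
    by (rule wp_solve_prog) (use assms(1) in \<open>simp_all add: base_def\<close>)
  have "350 * ((k1 E + 1) ^ k1 E * (m + length L + 1)) \<le> 350 * ((k1 E + 1) ^ k1 E * (m + 2 * n * m + 1))"
    using assms(5) by (intro mult_le_mono2) simp
  then show ?thesis
    by (intro wp_post[OF w]) (auto intro: order_trans)
qed

definition input_state :: "(nat \<Rightarrow> nat) \<Rightarrow> bool" where
  "input_state M \<longleftrightarrow> M 0 = n \<and> M 1 = m \<and> M 2 = c \<and> M 3 = k \<and>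
     (\<forall>e<m. M (4 + e + e) = fst (es ! e) \<and> M (4 + e + e + 1) = snd (es ! e)) \<and>
     (\<forall>x\<ge>B. M x = 0)"

lemma wp_main_prog:
  assumes R: "R rOne = 1" "R rZero = 0" "R rN = n" "R rM = m" "R rC = c" "R rK = k" "R rStamp = 0"
    and M: "input_state M" and n: "0 < n" and m: "0 < m"
  shows "wp main_prog (R, M) (\<lambda>u (R', M').
    u \<le> 1990 * ((k1 E + 1) ^ k1 E * (n * m)) \<and> R' 0 = (if multi_stc E c k then 1 else 0))"
proof -
  define R0 where "R0 = R(rX := 4, rBase := B, rStride := s)"
  define A where "A = (k1 E + 1) ^ k1 E"
  have high: "M (ad B a i) = 0" for a i
    using M by (simp add: input_state_def ad_def)
  have base0: "base R0 M"
    using R M high by (simp add: base_def R0_def input_state_def)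
  have w: "wp (Seq rows_prog (Seq adj_prog (Seq conf_prog solve_prog))) (R0, M) (\<lambda>u (R', M').
     u \<le> (s * 11 + 3) + ((m * 43 + 2) + ((m * (n * 122 + 10) + 3) + 350 * (A * (m + 2 * n * m + 1)))) \<and>
     R' 0 = (if multi_stc E c k then 1 else 0))"
  proof (rule wp_SeqI[OF wp_rows_prog[OF base0 high]])
    fix u1 R1 M1
    assume 1: "u1 \<le> s * 11 + 3 \<and> base R1 M1 \<and> rows M1 \<and> (\<forall>i. M1 (ad B aAdj i) = 0)"
    show "wp (Seq adj_prog (Seq conf_prog solve_prog)) (R1, M1) (\<lambda>t'. (\<lambda>u (R', M').
     u \<le> (s * 11 + 3) + ((m * 43 + 2) + ((m * (n * 122 + 10) + 3) + 350 * (A * (m + 2 * n * m + 1)))) \<and>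
     R' 0 = (if multi_stc E c k then 1 else 0)) (u1 + t'))"
    proof (rule wp_SeqI[OF wp_adj_prog])
      fix u2 R2 M2
      assume 2: "u2 \<le> m * 43 + 2 \<and> base R2 M2 \<and> rows M2 \<and> adj m M2"
      show "wp (Seq conf_prog solve_prog) (R2, M2) (\<lambda>t'. (\<lambda>t'. (\<lambda>u (R', M').
       u \<le> (s * 11 + 3) + ((m * 43 + 2) + ((m * (n * 122 + 10) + 3) + 350 * (A * (m + 2 * n * m + 1)))) \<and>
       R' 0 = (if multi_stc E c k then 1 else 0)) (u1 + t')) (u2 + t'))"
      proof (rule wp_SeqI[OF wp_conf_prog])
        fix u3 R3 M3
        assume 3: "u3 \<le> m * (n * 122 + 10) + 3 \<and> base R3 M3 \<and> rows M3 \<and>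
          (\<exists>L. listed L R3 M3 \<and> set L = {(i, j). cf i j} \<and> length L \<le> 2 * n * m)"
        then obtain L where L: "listed L R3 M3" "set L = {(i, j). cf i j}" "length L \<le> 2 * n * m"
          by blast
        have 4: "base R3 M3" "rows M3"
          using 3 by blast+
        show "wp solve_prog (R3, M3) (\<lambda>t'. (\<lambda>t'. (\<lambda>t'. (\<lambda>u (R', M').
         u \<le> (s * 11 + 3) + ((m * 43 + 2) + ((m * (n * 122 + 10) + 3) + 350 * (A * (m + 2 * n * m + 1)))) \<and>
         R' 0 = (if multi_stc E c k then 1 else 0)) (u1 + t')) (u2 + t')) (u3 + t'))"
        proof (rule wp_post[OF wp_rest[OF 4 L]])
          fix u R' M'
          assume 5: "u \<le> 350 * ((k1 E + 1) ^ k1 E * (m + 2 * n * m + 1)) \<and>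
            R' 0 = (if multi_stc E c k then 1 else 0)"
          have "u1 + (u2 + (u3 + u)) \<le>
            (s * 11 + 3) + ((m * 43 + 2) + ((m * (n * 122 + 10) + 3) + 350 * (A * (m + 2 * n * m + 1))))"
            using 1 2 3 5 unfolding A_def by (intro add_mono) simp_all
          with 5 show "case (R', M') of (R', M') \<Rightarrow> u1 + (u2 + (u3 + u)) \<le>
            (s * 11 + 3) + ((m * 43 + 2) + ((m * (n * 122 + 10) + 3) + 350 * (A * (m + 2 * n * m + 1)))) \<and>
            R' 0 = (if multi_stc E c k then 1 else 0)"
            by blast
        qed
      qed (use 2 in blast)+
    qed (use 1 in blast)+
  qed
  \<comment> \<open>As \<open>n\<close> and \<open>m\<close> are positive, each of \<open>n\<close>,
    \<open>m\<close> and 1 is at most \<open>n * m\<close>. The stages then contribute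
    \<open>36\<close>, \<open>45\<close>, \<open>135\<close> and \<open>4 * 350\<close> times this
    product, and with the 5 steps of setup the sum stays below 1990.\<close>
  have "5 + ((s * 11 + 3) + ((m * 43 + 2) + ((m * (n * 122 + 10) + 3) + 350 * (A * (m + 2 * n * m + 1)))))
    \<le> 1990 * (A * (n * m))"
  proof -
    have P: "n \<le> n * m" "m \<le> n * m" "1 \<le> n * m"
      using n m by (simp_all add: Suc_le_eq One_nat_def)
    have A: "n * m \<le> A * (n * m)"
      by (simp add: A_def Suc_le_eq One_nat_def)
    have "s * 11 + 3 = 11 * n + 11 * m + 14"
      by (simp add: s_def)
    then have "s * 11 + 3 \<le> 36 * (n * m)"
      using P by linarith
    moreover have "m * 43 + 2 \<le> 45 * (n * m)"
      using P by linarith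
    moreover have "m * (n * 122 + 10) + 3 \<le> 135 * (n * m)"
    proof -
      have "m * (n * 122 + 10) = 122 * (n * m) + 10 * m"
        by (simp add: distrib_left)
      then show ?thesis
        using P by linarith
    qed
    moreover have "A * (m + 2 * n * m + 1) \<le> A * (4 * (n * m))"
    proof (rule mult_le_mono2)
      show "m + 2 * n * m + 1 \<le> 4 * (n * m)"
        unfolding mult.assoc using P by linarith
    qed
    moreover have "A * (4 * (n * m)) = 4 * (A * (n * m))"
      by simp
    ultimately show ?thesis
      using A P by linarith
  qed
  note bound = this
  have five: "1 + (1 + (1 + (1 + (1 + x)))) = 5 + x" for x :: nat
    by simp
  have "wp main_prog (R, M) Q \<longleftrightarrow>
    wp (Seq rows_prog (Seq adj_prog (Seq conf_prog solve_prog))) (R0, M) (\<lambda>u. Q (5 + u))" for Q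
    using R unfolding main_prog_def wp_Seq[of "Const _ _"] wp_Seq[of "Add _ _ _"] wp_Const wp_Add
    by (simp add: R0_def B_def s_def fun_upd_twist five)
  note reduce = this
  show ?thesis
    unfolding reduce
    by (rule wp_post[OF w]) (use bound in \<open>auto simp: A_def\<close>)
qed

text \<open>Without edges nothing can be weak, so the answer is yes for all \<open>c\<close> and
  \<open>k\<close>. Otherwise an endpoint witnesses \<open>0 < n\<close>, the product in the bound
  is at least 1, and the 8 initial steps fit between 1990 and 2000.\<close>

lemma wp_multi_stc_prog:
  assumes "input_state M"
  shows "wp multi_stc_prog (\<lambda>_. 0, M) (\<lambda>u (R', M').
    u \<le> 2000 * max 1 ((k1 E + 1) ^ k1 E * (k1 E * card E + n * card E)) \<and>
    R' 0 = (if multi_stc E c k then 1 else 0))"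
proof (cases "m = 0")
  case True
  then have "coloring c (\<lambda>_. 0)" "uncolored (\<lambda>_. 0) = {}"
    by (auto simp: coloring_def uncolored_def)
  then have "multi_stc E c k"
    unfolding multi_stc_iff_coloring by (intro exI[of _ "\<lambda>_. 0"]) simp
  then show ?thesis
    using assms True by (simp add: multi_stc_prog_def input_state_def card_E)
next
  case False
  define R0 :: "nat \<Rightarrow> nat"
    where "R0 = (\<lambda>_. 0)(rOne := 1, rN := n, rM := m, rC := c, rX := 3, rK := k)"
  have "0 < n"
    using es_nth(1)[of 0] False by simp
  then have w: "wp main_prog (R0, M) (\<lambda>u (R', M').
    u \<le> 1990 * ((k1 E + 1) ^ k1 E * (n * m)) \<and> R' 0 = (if multi_stc E c k then 1 else 0))"
    using assms False by (intro wp_main_prog) (simp_all add: R0_def)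
  have "1 \<le> (k1 E + 1) ^ k1 E * (n * m)"
    using \<open>0 < n\<close> False by (simp add: Suc_le_eq One_nat_def)
  moreover have "(k1 E + 1) ^ k1 E * (n * m) \<le> max 1 ((k1 E + 1) ^ k1 E * (k1 E * card E + n * card E))"
    unfolding card_E by (rule max.coboundedI2, rule mult_le_mono2) simp
  ultimately have "8 + 1990 * ((k1 E + 1) ^ k1 E * (n * m)) \<le>
      2000 * max 1 ((k1 E + 1) ^ k1 E * (k1 E * card E + n * card E))"
    by linarith
  note bound = this
  have eight: "1 + (1 + (1 + (1 + (1 + (1 + (1 + (x + 1))))))) = 8 + x" for x :: nat
    by simp
  have "wp multi_stc_prog (\<lambda>_. 0, M) Q \<longleftrightarrow> wp main_prog (R0, M) (\<lambda>u. Q (8 + u))" for Q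
    using assms False
    by (simp add: multi_stc_prog_def input_state_def R0_def fun_upd_twist eight)
  note reduce = this
  show ?thesis
    unfolding reduce by (rule wp_post[OF w]) (use bound in auto)
qed

section \<open>The initial memory\<close>

lemma concat_pairs_nth:
  "i < length xs \<Longrightarrow> concat (map (\<lambda>(u, v). [u, v]) xs) ! (i + i) = fst (xs ! i) \<and>
     concat (map (\<lambda>(u, v). [u, v]) xs) ! (i + i + 1) = snd (xs ! i)"
proof (induction xs arbitrary: i)
  case (Cons x xs)
  then show ?case
    by (cases i; cases x) (simp_all add: One_nat_def)
qed simp

lemma length_concat_pairs: "length (concat (map (\<lambda>(u, v). [u, v]) xs)) = length xs + length xs"
  by (induction xs) auto

lemma input_state_init: "input_state (snd (init_state (input_word n es c k)))"
proof -
  define ps where "ps = concat (map (\<lambda>(u, v). [u, v]) es)"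
  have ps: "length ps = m + m" "\<And>e. e < m \<Longrightarrow> ps ! (e + e) = fst (es ! e) \<and> ps ! (e + e + 1) = snd (es ! e)"
    using length_concat_pairs concat_pairs_nth by (simp_all add: ps_def m_def)
  have word: "input_word n es c k = [n, m, c, k] @ ps"
    by (simp add: input_word_def ps_def m_def)
  have four: "length [n, m, c, k] = 4"
    by simp
  have state: "snd (init_state (input_word n es c k)) i =
      (if i < 4 then [n, m, c, k] ! i else if i < B then ps ! (i - 4) else 0)" for i
    unfolding init_state_def word nth_append length_append four by (simp add: B_def ps(1) del: append_Cons append.simps)
  show ?thesis
    unfolding input_state_def state
  proof (intro conjI allI impI)
    fix e assume e: "e < m"
    then have "4 + e + e < B" "4 + e + e + 1 < B" "\<not> 4 + e + e < 4" "\<not> 4 + e + e + 1 < 4"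
      "4 + e + e - 4 = e + e" "4 + e + e + 1 - 4 = e + e + 1"
      by (simp_all add: B_def)
    then show "(if 4 + e + e < 4 then [n, m, c, k] ! (4 + e + e)
         else if 4 + e + e < B then ps ! (4 + e + e - 4) else 0) = fst (es ! e)"
      "(if 4 + e + e + 1 < 4 then [n, m, c, k] ! (4 + e + e + 1)
         else if 4 + e + e + 1 < B then ps ! (4 + e + e + 1 - 4) else 0) = snd (es ! e)"
      using ps(2)[OF e] by (simp_all only: if_True if_False)
  qed (simp_all add: B_def)
qed

end

theorem theorem4:
  "\<exists>p. solves_multi_stc_in_time p
     (\<lambda>n E c k. (k1 E + 1) ^ k1 E * (k1 E * card E + n * card E))"
proof (rule exI[of _ multi_stc_prog], unfold solves_multi_stc_in_time_def,
    rule exI[of _ 2000], intro allI impI)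
  fix n E es c k
  assume "ugraph {..<n} E" "edge_list es E"
  then interpret ram_input n E es c k
    by unfold_locales
  have "init_state (input_word n es c k) = (\<lambda>_. 0, snd (init_state (input_word n es c k)))"
    by (simp add: init_state_def)
  with wp_multi_stc_prog[OF input_state_init]
  show "\<exists>t s. exec multi_stc_prog (init_state (input_word n es c k)) t s \<and>
      answer s = (if multi_stc E c k then 1 else 0) \<and>
      t \<le> 2000 * max 1 ((k1 E + 1) ^ k1 E * (k1 E * card E + n * card E))"
    unfolding wp_def answer_def by fastforce
qed

end
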